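(* Let $\alpha, n$ be nonnegative integers and let $p_1,\dots,p_{\alpha+1}$ be odd primes (not necessarily distinct) such that $b_{13}\left(\frac{p_i-1}{2}\right)\equiv 0 \pmod{13}$ for every $1\le i\le \alpha+1$. Then for any integer $j$ with $j \not\equiv 0 \pmod{p_{\alpha+1}}$, we have $$ b_{13}\left(p_1^2\cdots p_{\alpha+1}^2n+\frac{p_1^2\cdots p_{\alpha}^2p_{\alpha +1}(2j+p_{\alpha +1})-1}{2}\right)\equiv 0 \pmod{13}.$$
   Context: For a positive integer $\ell$, an $\ell$-regular partition of a nonnegative integer $n$ is a partition of $n$ none of whose parts is divisible by $\ell$. The number of $\ell$-regular partitions of $n$ is denoted $b_\ell(n)$, with the conventions $b_\ell(0)=1$ and $b_\ell(n)=0$ for $n<0$. Its generating function is $\sum_{n=0}^\infty b_\ell(n)q^n=\prod_{i\ge 1}\frac{1-q^{\ell i}}{1-q^i}$. When $\alpha=0$, the empty product $p_1^2\cdots p_\alpha^2$ equals $1$. *)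

theory Defs
  imports "HOL-Library.Multiset" "HOL-Number_Theory.Number_Theory"
begin

definition partitions_of :: "nat \<Rightarrow> nat multiset set" where
  "partitions_of n = {P. (\<forall>x \<in># P. 0 < x) \<and> \<Sum>\<^sub># P = n}"

definition regular_partitions :: "nat \<Rightarrow> nat \<Rightarrow> nat multiset set" where
  "regular_partitions l n = {P \<in> partitions_of n. \<forall>x \<in># P. \<not> l dvd x}"

text \<open>The argument is an integer because of the convention that the count is zero for
  negative arguments.\<close>
definition b :: "nat \<Rightarrow> int \<Rightarrow> nat" where
  "b l n = (if n < 0 then 0 else card (regular_partitions l (nat n)))"

lemma finite_partitions_of: "finite (partitions_of n)"
proof -
  have size_le: "size P \<le> \<Sum>\<^sub># P" if "\<forall>x \<in># P. 0 < x" for P :: "nat multiset"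
    using that
  proof (induction P)
    case (add x P)
    then have "size P \<le> \<Sum>\<^sub># P" and "0 < x" by simp_all
    then show ?case by simp
  qed simp
  have mem_le: "x \<le> \<Sum>\<^sub># P" if x: "x \<in># P" for x :: nat and P
  proof -
    obtain Q where "P = add_mset x Q" using multi_member_split[OF x] by blast
    then show ?thesis by simp
  qed
  have "partitions_of n \<subseteq> mset ` {xs. set xs \<subseteq> {..n} \<and> length xs \<le> n}"
  proof
    fix P assume "P \<in> partitions_of n"
    then have pos: "\<forall>x \<in># P. 0 < x" and sum: "\<Sum>\<^sub># P = n"
      unfolding partitions_of_def by blast+
    obtain xs where xs: "mset xs = P" using ex_mset by blast
    have "set xs \<subseteq> {..n}"
    proof
      fix x assume "x \<in> set xs"
      then have "x \<in># P" using xs by (metis set_mset_mset)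
      from mem_le[OF this] sum show "x \<in> {..n}" by simp
    qed
    moreover have "length xs \<le> n"
      using size_le[OF pos] sum xs by (metis size_mset)
    ultimately show "P \<in> mset ` {xs. set xs \<subseteq> {..n} \<and> length xs \<le> n}"
      using xs by blast
  qed
  then show ?thesis by (rule finite_subset) (simp add: finite_lists_length_le)
qed

lemma finite_regular_partitions: "finite (regular_partitions l n)"
  by (rule finite_subset[OF _ finite_partitions_of[of n]]) (simp add: regular_partitions_def)

lemma b_0 [simp]: "b l 0 = 1"
proof -
  have "regular_partitions l 0 = {{#}}"
  proof (intro equalityI subsetI)
    fix P assume "P \<in> regular_partitions l 0"
    then have pos: "\<forall>x \<in># P. 0 < x" and sum: "\<Sum>\<^sub># P = 0"
      unfolding regular_partitions_def partitions_of_def by blast+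
    show "P \<in> {{#}}" using pos sum by (cases P) simp_all
  qed (simp add: regular_partitions_def partitions_of_def)
  then show ?thesis by (simp add: b_def)
qed

lemma b_neg: "n < 0 \<Longrightarrow> b l n = 0"
  by (simp add: b_def)

end

theory Submission
  imports Defs
    "HOL-Computational_Algebra.Polynomial"
    "HOL-Computational_Algebra.Formal_Power_Series"
begin

text \<open>Write $b_{13}(N)$ for the number of 13-regular partitions of \<open>N\<close>.  Modulo 13 the generating
function $\prod_i (1-q^{13i})/(1-q^i)$ becomes $\prod_i (1-q^i)^{12}$, so $b_{13}(N)$ is congruent
to the coefficient $a(2N+1)$ of the cusp form $\eta(2z)^{12} = \sum_m a(m) q^m$ of weight 6 and level 4.
That form is a Hecke eigenform: $a(p)\, a(m) = a(pm) + p^5 a(m/p)$ for odd primes \<open>p\<close>.  Hence if 13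
divides $a(p)$, then 13 divides $a(pm)$ for every \<open>m\<close> prime to \<open>p\<close>, and 13 divides $a(p^2 m)$
whenever it divides $a(m)$.  The theorem follows, because the argument \<open>A\<close> of \<open>b\<close> in its conclusion satisfies
$2A + 1 = p_1^2 \cdots p_\alpha^2 \cdot r \cdot (2(rn + j) + r)$ with $r = p_{\alpha+1}$, and \<open>r\<close> does not
divide the last factor.

The Hecke relation is obtained from the arithmetic of integer quaternions instead of modular forms.  For a
quaternion \<open>x\<close>, the map $v \mapsto \bar x v x$ acts on purely imaginary \<open>v\<close>, and summing
the form $v_1^2 - v_2^2$ over its images under all \<open>x\<close> of norm \<open>n\<close> multiplies it by a number
\<open>hecke_eigenvalue n\<close> (lemma \<open>sum_test_form_conjugate\<close>).  Since the actions of \<open>x\<close> and \<open>y\<close> compose to that of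
\<open>x * y\<close>, the product of two such numbers is a sum over products \<open>x * y\<close>, in which each quaternion is weighted by its
number of factorizations; these are counted by a Euclidean argument.  The result is
\<open>hecke_relation\<close>.

That the eigenvalues are the coefficients of $\eta^{12}$ up to a factor 8
(theorem \<open>hecke_eigenvalue_eq_coeff\<close>) comes from Jacobi's identity
$\prod_i (1-q^i)^3 = \sum_{j \ge 0} (-1)^j (2j+1) q^{j(j+1)/2}$, whose fourth power is a sum over quadruples of odd
integers with weight their signed product.  A linear change of variables turns this into the sum of
\<open>eigen_poly\<close> over quaternions of fixed norm.  Jacobi's identity itself is a limit of a polynomial identity, obtained by
differentiating a finite product expanded in q-binomial coefficients.\<close>

section \<open>Quaternions with integer coordinates\<close>

codatatype quat = Quat (re: int) (im1: int) (im2: int) (im3: int)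

lemma quat_eq_iff: "x = y \<longleftrightarrow> re x = re y \<and> im1 x = im1 y \<and> im2 x = im2 y \<and> im3 x = im3 y"
  by (auto intro: quat.expand)

instantiation quat :: ring_1
begin

primcorec zero_quat where
  "re 0 = 0" | "im1 0 = 0" | "im2 0 = 0" | "im3 0 = 0"

primcorec one_quat where
  "re 1 = 1" | "im1 1 = 0" | "im2 1 = 0" | "im3 1 = 0"

primcorec plus_quat where
  "re (x + y) = re x + re y"
| "im1 (x + y) = im1 x + im1 y"
| "im2 (x + y) = im2 x + im2 y"
| "im3 (x + y) = im3 x + im3 y"

primcorec uminus_quat where
  "re (- x) = - re x"
| "im1 (- x) = - im1 x"
| "im2 (- x) = - im2 x"
| "im3 (- x) = - im3 x"

primcorec minus_quat where
  "re (x - y) = re x - re y"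
| "im1 (x - y) = im1 x - im1 y"
| "im2 (x - y) = im2 x - im2 y"
| "im3 (x - y) = im3 x - im3 y"

primcorec times_quat where
  "re (x * y) = re x * re y - im1 x * im1 y - im2 x * im2 y - im3 x * im3 y"
| "im1 (x * y) = re x * im1 y + im1 x * re y + im2 x * im3 y - im3 x * im2 y"
| "im2 (x * y) = re x * im2 y - im1 x * im3 y + im2 x * re y + im3 x * im1 y"
| "im3 (x * y) = re x * im3 y + im1 x * im2 y - im2 x * im1 y + im3 x * re y"

instance
  by standard (simp_all add: quat_eq_iff algebra_simps)

end

lemma quat_of_nat_sel [simp]:
  "re (of_nat k) = int k" "im1 (of_nat k) = 0" "im2 (of_nat k) = 0" "im3 (of_nat k) = 0"
  by (induction k) simp_all

lemma quat_of_int_sel [simp]: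
  "re (of_int k) = k" "im1 (of_int k) = 0" "im2 (of_int k) = 0" "im3 (of_int k) = 0"
  by (cases k rule: int_cases2; simp)+

definition qconj :: "quat \<Rightarrow> quat" where
  "qconj x = Quat (re x) (- im1 x) (- im2 x) (- im3 x)"

definition qnorm :: "quat \<Rightarrow> int" where
  "qnorm x = (re x)\<^sup>2 + (im1 x)\<^sup>2 + (im2 x)\<^sup>2 + (im3 x)\<^sup>2"

lemma qconj_sel [simp]:
  "re (qconj x) = re x" "im1 (qconj x) = - im1 x" "im2 (qconj x) = - im2 x" "im3 (qconj x) = - im3 x"
  by (simp_all add: qconj_def)

lemma qconj_mult: "qconj (x * y) = qconj y * qconj x"
  by (simp add: quat_eq_iff algebra_simps)

lemma qconj_qconj [simp]: "qconj (qconj x) = x"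
  by (simp add: quat_eq_iff)

lemma qconj_mult_self: "qconj x * x = of_int (qnorm x)" "x * qconj x = of_int (qnorm x)"
  by (simp_all add: quat_eq_iff qnorm_def power2_eq_square algebra_simps)

lemma qnorm_mult: "qnorm (x * y) = qnorm x * qnorm y"
  by (simp add: qnorm_def power2_eq_square algebra_simps)

lemma qnorm_nonneg [simp]: "qnorm x \<ge> 0"
  by (simp add: qnorm_def)

lemma qnorm_eq_0_iff [simp]: "qnorm x = 0 \<longleftrightarrow> x = 0"
  by (simp add: qnorm_def quat_eq_iff add_nonneg_eq_0_iff)

lemma qnorm_qconj [simp]: "qnorm (qconj x) = qnorm x"
  by (simp add: qnorm_def)

lemma qnorm_of_int [simp]: "qnorm (of_int k) = k\<^sup>2"
  by (simp add: qnorm_def)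

lemma qnorm_zero [simp]: "qnorm 0 = 0"
  by (simp add: qnorm_def)

lemma quat_mult_left_cancel:
  fixes x y z :: quat
  assumes "x * y = x * z" "x \<noteq> 0"
  shows "y = z"
proof -
  have "qconj x * (x * y) = qconj x * (x * z)" using assms by simp
  then have "of_int (qnorm x) * y = of_int (qnorm x) * z"
    by (simp add: mult.assoc [symmetric] qconj_mult_self)
  moreover have "qnorm x \<noteq> 0" using assms by simp
  ultimately show ?thesis by (auto simp: quat_eq_iff)
qed

definition sphere :: "int \<Rightarrow> quat set" where
  "sphere n = {x. qnorm x = n}"

lemma mem_sphere [simp]: "x \<in> sphere n \<longleftrightarrow> qnorm x = n"
  by (simp add: sphere_def)

lemma abs_le_square_int: "\<bar>a\<bar> \<le> (a::int)\<^sup>2"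
proof (cases "a = 0")
  case False
  then have "\<bar>a\<bar> \<le> \<bar>a\<bar> ^ 2" by (intro self_le_power) auto
  then show ?thesis by simp
qed simp

lemma abs_coordinates_le_qnorm:
  "\<bar>re x\<bar> \<le> qnorm x" "\<bar>im1 x\<bar> \<le> qnorm x" "\<bar>im2 x\<bar> \<le> qnorm x" "\<bar>im3 x\<bar> \<le> qnorm x"
  unfolding qnorm_def
  using abs_le_square_int[of "re x"] abs_le_square_int[of "im1 x"]
    abs_le_square_int[of "im2 x"] abs_le_square_int[of "im3 x"]
    zero_le_power2[of "re x"] zero_le_power2[of "im1 x"]
    zero_le_power2[of "im2 x"] zero_le_power2[of "im3 x"]
  by linarith+

lemma finite_sphere [simp]: "finite (sphere n)"
proof (rule finite_subset)
  let ?I = "{- n..n}"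
  show "sphere n \<subseteq> (\<lambda>(a, b, c, d). Quat a b c d) ` (?I \<times> ?I \<times> ?I \<times> ?I)"
  proof
    fix x assume "x \<in> sphere n"
    then have "(re x, im1 x, im2 x, im3 x) \<in> ?I \<times> ?I \<times> ?I \<times> ?I"
      using abs_coordinates_le_qnorm[of x] by (auto simp: abs_le_iff)
    then show "x \<in> (\<lambda>(a, b, c, d). Quat a b c d) ` (?I \<times> ?I \<times> ?I \<times> ?I)"
      by (rule rev_image_eqI) simp
  qed
qed simp

lemma card_units: "card (sphere 1) = 8"
proof -
  have "sphere 1 = {Quat 1 0 0 0, Quat (-1) 0 0 0, Quat 0 1 0 0, Quat 0 (-1) 0 0,
      Quat 0 0 1 0, Quat 0 0 (-1) 0, Quat 0 0 0 1, Quat 0 0 0 (-1)}" (is "_ = ?S")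
  proof
    show "sphere 1 \<subseteq> ?S"
    proof
      fix x assume x: "x \<in> sphere 1"
      then have sum: "(re x)\<^sup>2 + (im1 x)\<^sup>2 + (im2 x)\<^sup>2 + (im3 x)\<^sup>2 = 1" by (simp add: qnorm_def)
      have "re x \<in> {-1, 0, 1}" "im1 x \<in> {-1, 0, 1}" "im2 x \<in> {-1, 0, 1}" "im3 x \<in> {-1, 0, 1}"
        using abs_coordinates_le_qnorm[of x] x by auto
      with sum show "x \<in> ?S" 
        by (elim insertE emptyE) (simp_all add: quat_eq_iff)
    qed
  qed (auto simp: qnorm_def)
  then show ?thesis by simp
qed

text \<open>Rounding each \<open>t / m\<close> to the nearest integer leaves remainders below \<open>m / 2\<close> in absolute value, the
inequality being strict because \<open>m\<close> is odd; their squares therefore sum to less than $m^2$.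
If that sum is even and nonzero, its largest remainder \<open>e\<close> is replaced by \<open>e - m * sgn e\<close>, which changes the sum by
$m^2 - 2m|e|$: an odd number, and small enough since the sum is at most $4e^2 < 2m|e|$.\<close>
lemma odd_rounding:
  fixes m :: int and t0 t1 t2 t3 :: int
  assumes "odd m" "m > 0"
  shows "\<exists>q0 q1 q2 q3.
    (t0 = m * q0 \<and> t1 = m * q1 \<and> t2 = m * q2 \<and> t3 = m * q3) \<or>
    (let N = (t0 - m * q0)\<^sup>2 + (t1 - m * q1)\<^sup>2 + (t2 - m * q2)\<^sup>2 + (t3 - m * q3)\<^sup>2
     in odd N \<and> N < m\<^sup>2)"
proof -
  have round: "\<exists>q. 2 * \<bar>t - m * q\<bar> < m" for t :: int
  proof -
    obtain k where k: "m = 2 * k + 1" using \<open>odd m\<close> by (auto elim: oddE)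
    define D r where "D = m * ((t + k) div m)" and "r = (t + k) mod m"
    have "t + k = D + r" by (simp add: D_def r_def)
    moreover have "0 \<le> r" "r < m" using \<open>m > 0\<close> by (auto simp: r_def)
    ultimately have "- k \<le> t - D \<and> t - D \<le> k" using k by linarith
    then have "\<bar>t - D\<bar> \<le> k" by (simp add: abs_le_iff)
    then have "2 * \<bar>t - D\<bar> < m" using k by simp
    then show ?thesis unfolding D_def by blast
  qed
  obtain q0 q1 q2 q3 where q: "2 * \<bar>t0 - m * q0\<bar> < m" "2 * \<bar>t1 - m * q1\<bar> < m"
    "2 * \<bar>t2 - m * q2\<bar> < m" "2 * \<bar>t3 - m * q3\<bar> < m"
    using round by metis
  define e0 e1 e2 e3 where e: "e0 = t0 - m * q0" "e1 = t1 - m * q1" "e2 = t2 - m * q2" "e3 = t3 - m * q3"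
  have small: "2 * \<bar>e0\<bar> < m" "2 * \<bar>e1\<bar> < m" "2 * \<bar>e2\<bar> < m" "2 * \<bar>e3\<bar> < m"
    using q e by auto
  have le_sq: "4 * a\<^sup>2 < m\<^sup>2" if "2 * \<bar>a\<bar> < m" for a
  proof -
    have "(2 * \<bar>a\<bar>)\<^sup>2 < m\<^sup>2" by (rule power_strict_mono) (use that in auto)
    then show ?thesis by (simp add: power_mult_distrib)
  qed
  have sq_small: "e0\<^sup>2 + e1\<^sup>2 + e2\<^sup>2 + e3\<^sup>2 < m\<^sup>2"
    using small[THEN le_sq] by linarith
  \<comment> \<open>Here \<open>e\<close> is a remainder of largest absolute value and \<open>r\<close> the sum of the other three squares.\<close>
  have flip: "\<exists>s. odd ((e - m * s)\<^sup>2 + r) \<and> (e - m * s)\<^sup>2 + r < m\<^sup>2"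
    if "even (e\<^sup>2 + r)" "r \<le> 3 * e\<^sup>2" "2 * \<bar>e\<bar> < m" "e \<noteq> 0" for e r
  proof -
    have exp: "(e - m * sgn e)\<^sup>2 + r = e\<^sup>2 + r + m\<^sup>2 - 2 * m * \<bar>e\<bar>"
      using that(4) by (simp add: power2_eq_square algebra_simps sgn_if abs_if)
    have "2 * \<bar>e\<bar> * (2 * \<bar>e\<bar>) < m * (2 * \<bar>e\<bar>)"
      by (rule mult_strict_right_mono) (use that in auto)
    then have "4 * e\<^sup>2 < 2 * m * \<bar>e\<bar>" by (simp add: power2_eq_square abs_mult_self_eq algebra_simps)
    then have "(e - m * sgn e)\<^sup>2 + r < m\<^sup>2" using exp that(2) by linarith
    moreover have "odd ((e - m * sgn e)\<^sup>2 + r)" unfolding exp using that(1) \<open>odd m\<close> by auto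
    ultimately show ?thesis by blast
  qed
  consider "e0 = 0 \<and> e1 = 0 \<and> e2 = 0 \<and> e3 = 0" | "odd (e0\<^sup>2 + e1\<^sup>2 + e2\<^sup>2 + e3\<^sup>2)"
    | "even (e0\<^sup>2 + e1\<^sup>2 + e2\<^sup>2 + e3\<^sup>2)" "\<not> (e0 = 0 \<and> e1 = 0 \<and> e2 = 0 \<and> e3 = 0)" by blast
  then show ?thesis
  proof cases
    case 1
    then show ?thesis using e by (metis eq_iff_diff_eq_0)
  next
    case 2
    then show ?thesis using e sq_small unfolding Let_def by blast
  next
    case 3
    consider (0) "e1\<^sup>2 \<le> e0\<^sup>2" "e2\<^sup>2 \<le> e0\<^sup>2" "e3\<^sup>2 \<le> e0\<^sup>2" | (1) "e0\<^sup>2 \<le> e1\<^sup>2" "e2\<^sup>2 \<le> e1\<^sup>2" "e3\<^sup>2 \<le> e1\<^sup>2"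
      | (2) "e0\<^sup>2 \<le> e2\<^sup>2" "e1\<^sup>2 \<le> e2\<^sup>2" "e3\<^sup>2 \<le> e2\<^sup>2" | (3) "e0\<^sup>2 \<le> e3\<^sup>2" "e1\<^sup>2 \<le> e3\<^sup>2" "e2\<^sup>2 \<le> e3\<^sup>2"
      by linarith
    then show ?thesis
    proof cases
      case 0
      then have "e0 \<noteq> 0" using 3 by auto
      then obtain s where "odd ((e0 - m * s)\<^sup>2 + (e1\<^sup>2 + e2\<^sup>2 + e3\<^sup>2))"
          "(e0 - m * s)\<^sup>2 + (e1\<^sup>2 + e2\<^sup>2 + e3\<^sup>2) < m\<^sup>2"
        using flip[of e0 "e1\<^sup>2 + e2\<^sup>2 + e3\<^sup>2"] 3 0 small by (auto simp: add.assoc)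
      then show ?thesis unfolding Let_def e
        by (intro exI[of _ "q0 + s"] exI[of _ q1] exI[of _ q2] exI[of _ q3]) (simp add: algebra_simps)
    next
      case 1
      then have "e1 \<noteq> 0" using 3 by auto
      then obtain s where "odd ((e1 - m * s)\<^sup>2 + (e0\<^sup>2 + e2\<^sup>2 + e3\<^sup>2))"
          "(e1 - m * s)\<^sup>2 + (e0\<^sup>2 + e2\<^sup>2 + e3\<^sup>2) < m\<^sup>2"
        using flip[of e1 "e0\<^sup>2 + e2\<^sup>2 + e3\<^sup>2"] 3 1 small by (auto simp: ac_simps)
      then show ?thesis unfolding Let_def e
        by (intro exI[of _ q0] exI[of _ "q1 + s"] exI[of _ q2] exI[of _ q3]) (simp add: algebra_simps)
    next
      case 2
      then have "e2 \<noteq> 0" using 3 by auto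
      then obtain s where "odd ((e2 - m * s)\<^sup>2 + (e0\<^sup>2 + e1\<^sup>2 + e3\<^sup>2))"
          "(e2 - m * s)\<^sup>2 + (e0\<^sup>2 + e1\<^sup>2 + e3\<^sup>2) < m\<^sup>2"
        using flip[of e2 "e0\<^sup>2 + e1\<^sup>2 + e3\<^sup>2"] 3 2 small by (auto simp: ac_simps)
      then show ?thesis unfolding Let_def e
        by (intro exI[of _ q0] exI[of _ q1] exI[of _ "q2 + s"] exI[of _ q3]) (simp add: algebra_simps)
    next
      case 3
      then have "e3 \<noteq> 0" using \<open>\<not> (e0 = 0 \<and> e1 = 0 \<and> e2 = 0 \<and> e3 = 0)\<close> by auto
      then obtain s where "odd ((e3 - m * s)\<^sup>2 + (e0\<^sup>2 + e1\<^sup>2 + e2\<^sup>2))"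
          "(e3 - m * s)\<^sup>2 + (e0\<^sup>2 + e1\<^sup>2 + e2\<^sup>2) < m\<^sup>2"
        using flip[of e3 "e0\<^sup>2 + e1\<^sup>2 + e2\<^sup>2"] \<open>even (e0\<^sup>2 + e1\<^sup>2 + e2\<^sup>2 + e3\<^sup>2)\<close> 3 small by (auto simp: ac_simps)
      then show ?thesis unfolding Let_def e
        by (intro exI[of _ q0] exI[of _ q1] exI[of _ q2] exI[of _ "q3 + s"]) (simp add: algebra_simps)
    qed
  qed
qed

text \<open>The integer quaternions are not Euclidean: if all coordinates of the exact quotient lie halfway between
integers, every remainder has at least the norm of the divisor.  For a divisor of odd norm this cannot
happen, and the remainder can even be kept of odd norm, so that division can be iterated.\<close>
lemma odd_division:
  assumes "odd (qnorm x)"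
  shows "\<exists>q. a = x * q \<or> (odd (qnorm (a - x * q)) \<and> qnorm (a - x * q) < qnorm x)"
proof -
  define m where "m = qnorm x"
  define t where "t = qconj x * a"
  have "odd m" "m \<ge> 0" using assms by (simp_all add: m_def)
  then have m: "odd m" "m > 0" by (auto simp: le_less)
  obtain q0 q1 q2 q3 where
    q: "(re t = m * q0 \<and> im1 t = m * q1 \<and> im2 t = m * q2 \<and> im3 t = m * q3) \<or>
    (let N = (re t - m * q0)\<^sup>2 + (im1 t - m * q1)\<^sup>2 + (im2 t - m * q2)\<^sup>2 + (im3 t - m * q3)\<^sup>2
     in odd N \<and> N < m\<^sup>2)"
    using odd_rounding[OF m] by blast
  define q where "q = Quat q0 q1 q2 q3"
  have eq: "qconj x * (a - x * q) = t - of_int m * q"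
    by (simp add: t_def m_def right_diff_distrib mult.assoc [symmetric] qconj_mult_self)
  have N: "qnorm (t - of_int m * q) = m * qnorm (a - x * q)"
    unfolding eq [symmetric] qnorm_mult by (simp add: m_def)
  show ?thesis
  proof (cases "t = of_int m * q")
    case True
    then have "a - x * q = 0" using N m by simp
    then show ?thesis by (intro exI[of _ q]) simp
  next
    case False
    then have "odd (qnorm (t - of_int m * q)) \<and> qnorm (t - of_int m * q) < m\<^sup>2"
      using q by (auto simp: q_def quat_eq_iff qnorm_def Let_def)
    then have "odd (qnorm (a - x * q)) \<and> qnorm (a - x * q) < m"
      unfolding N power2_eq_square using m by simp
    then show ?thesis unfolding m_def by blast
  qed
qed

text \<open>The right ideal generated by \<open>w\<close> and \<open>p\<close> contains elements of odd norm, for instance \<open>p\<close>; by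
division, one of least odd norm divides all the others on the left.\<close>
lemma right_ideal_principal:
  fixes w :: quat and p :: int
  assumes p: "odd p" "p > 0"
  shows "\<exists>x a b. x = w * a + of_int p * b \<and> (\<exists>y. w = x * y) \<and> (\<exists>z. of_int p = x * z)"
proof -
  define I where "I = {w * a + of_int p * b | a b. True}"
  have I_intro: "w * a + of_int p * b \<in> I" for a b unfolding I_def by blast
  have w_I: "w \<in> I" using I_intro[of 1 0] by simp
  have p_I: "of_int p \<in> I" using I_intro[of 0 1] by simp
  have diff_I: "u - v * q \<in> I" if uv: "u \<in> I" "v \<in> I" for u v q
  proof -
    obtain a b c d where "u = w * a + of_int p * b" "v = w * c + of_int p * d"
      using uv unfolding I_def by blast
    then have "u - v * q = w * (a - c * q) + of_int p * (b - d * q)"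
      by (simp add: algebra_simps)
    then show ?thesis using I_intro by simp
  qed
  have p_odd: "of_int p \<in> I \<and> odd (qnorm (of_int p))" using p_I p by simp
  obtain x where x: "x \<in> I" "odd (qnorm x)"
    and min: "\<And>y. y \<in> I \<Longrightarrow> odd (qnorm y) \<Longrightarrow> nat (qnorm x) \<le> nat (qnorm y)"
    using ex_has_least_nat[of "\<lambda>x. x \<in> I \<and> odd (qnorm x)", OF p_odd, of "\<lambda>x. nat (qnorm x)"] by blast
  have "\<exists>y. a = x * y" if "a \<in> I" for a
  proof -
    obtain q where q: "a = x * q \<or> (odd (qnorm (a - x * q)) \<and> qnorm (a - x * q) < qnorm x)"
      using odd_division[OF x(2)] by blast
    have "\<not> (odd (qnorm (a - x * q)) \<and> qnorm (a - x * q) < qnorm x)"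
      using min[OF diff_I[OF that x(1)], of q] qnorm_nonneg[of "a - x * q"] qnorm_nonneg[of x] by linarith
    with q show ?thesis by blast
  qed
  then have "\<exists>y. w = x * y" "\<exists>z. of_int p = x * z" using w_I p_I by blast+
  then show ?thesis using x(1) unfolding I_def by blast
qed

lemma qnorm_add_multiple_dvd:
  assumes "p dvd qnorm u"
  shows "p dvd qnorm (u + of_int p * v)"
proof -
  have "qnorm (u + of_int p * v) = qnorm u + p * (2 * (re u * re v + im1 u * im1 v
      + im2 u * im2 v + im3 u * im3 v) + p * qnorm v)"
    by (simp add: qnorm_def power2_eq_square algebra_simps)
  then show ?thesis using assms by simp
qed

lemma int_square_prime_factor:
  fixes p k l :: int
  assumes "prime p" "p\<^sup>2 = k * l" "k \<ge> 0" "p dvd k"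
  shows "k = p \<or> k = p\<^sup>2 \<and> l = 1"
proof -
  obtain c where c: "k = p * c" using assms by blast
  have p0: "p > 0" using assms(1) by (simp add: prime_gt_0_int)
  have "p = c * l" using assms(2) c p0 by (simp add: power2_eq_square)
  moreover have "c \<ge> 0" using assms(3) c p0 by (simp add: zero_le_mult_iff)
  ultimately have "c = 1 \<or> c = p" using assms(1) by (metis dvd_triv_left prime_int_iff)
  then show ?thesis using c \<open>p = c * l\<close> p0 by (auto simp: power2_eq_square)
qed

text \<open>The generator \<open>x\<close> of the ideal generated by \<open>w\<close> and \<open>p\<close> divides \<open>p\<close>, so its norm divides $p^2$.  The norm is a multiple
of \<open>p\<close>, because modulo \<open>p\<close> it is a multiple of the norm of \<open>w\<close>, and it is not $p^2$, as otherwise \<open>x\<close> would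
be \<open>p\<close> times a unit and \<open>p\<close> would divide \<open>w\<close>.\<close>
lemma left_divisor_of_prime_norm:
  assumes p: "prime p" "odd p" and w: "p dvd qnorm w" "\<nexists>w'. w = of_int p * w'"
  shows "\<exists>x a b. qnorm x = p \<and> x = w * a + of_int p * b \<and> (\<exists>y. w = x * y)"
proof -
  have p0: "p > 0" using p(1) by (simp add: prime_gt_0_int)
  obtain x a b y z where x: "x = w * a + of_int p * b" "w = x * y" "of_int p = x * z"
    using right_ideal_principal[OF p(2) p0, of w] by blast
  have "p\<^sup>2 = qnorm x * qnorm z" using x(3) by (metis qnorm_mult qnorm_of_int)
  moreover have "p dvd qnorm x" unfolding x(1)
    by (rule qnorm_add_multiple_dvd) (use w in \<open>simp add: qnorm_mult\<close>)
  ultimately have "qnorm x = p \<or> qnorm x = p\<^sup>2 \<and> qnorm z = 1"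
    using int_square_prime_factor[OF p(1) _ qnorm_nonneg] by blast
  moreover have "qnorm z \<noteq> 1"
  proof
    assume "qnorm z = 1"
    then have "of_int p * qconj z = x" unfolding x(3) mult.assoc qconj_mult_self by simp
    then have "w = of_int p * (qconj z * y)" using x(2) by (simp add: mult.assoc [symmetric])
    then show False using w(2) by blast
  qed
  ultimately show ?thesis using x by blast
qed

definition factorizations :: "int \<Rightarrow> quat \<Rightarrow> (quat \<times> quat) set" where
  "factorizations p w = {(x, y). qnorm x = p \<and> x * y = w}"

text \<open>If \<open>x * y = w\<close> with \<open>x\<close> of norm \<open>p\<close>, then \<open>x\<close> divides both \<open>w\<close> and \<open>p\<close>, hence divides the generator \<open>x0\<close> of the ideal
they generate; as \<open>x\<close> and \<open>x0\<close> have the same norm, they differ by one of the eight units.\<close>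
lemma card_factorizations_primitive:
  assumes p: "prime p" "odd p" and w: "p dvd qnorm w" "\<nexists>w'. w = of_int p * w'"
  shows "card (factorizations p w) = 8"
proof -
  have p0: "p > 0" using p(1) by (simp add: prime_gt_0_int)
  obtain x0 a b y0 where x0: "qnorm x0 = p" "x0 = w * a + of_int p * b" "w = x0 * y0"
    using left_divisor_of_prime_norm[OF assms] by blast
  have nz: "x \<noteq> 0" if "qnorm x = p" for x using that p0 by force
  define f where "f u = (x0 * u, qconj u * y0)" for u
  have "inj_on f (sphere 1)"
  proof (rule inj_onI)
    fix u v assume "f u = f v"
    then have "x0 * u = x0 * v" by (simp add: f_def)
    then show "u = v" using quat_mult_left_cancel nz[OF x0(1)] by blast
  qed
  moreover have "f u \<in> factorizations p w" if u: "qnorm u = 1" for u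
  proof -
    have "x0 * u * (qconj u * y0) = x0 * (u * qconj u) * y0" by (simp only: mult.assoc)
    also have "\<dots> = w" using u x0(3) by (simp add: qconj_mult_self)
    finally show ?thesis using u x0(1) by (simp add: f_def factorizations_def qnorm_mult)
  qed
  moreover have "\<exists>u. qnorm u = 1 \<and> (x, y) = f u" if xy: "(x, y) \<in> factorizations p w" for x y
  proof -
    have x: "qnorm x = p" "x * y = w" using xy by (auto simp: factorizations_def)
    have "of_int p * b = x * (qconj x * b)"
      by (simp add: x(1) mult.assoc [symmetric] qconj_mult_self)
    moreover have "w * a = x * (y * a)" by (simp add: x(2) [symmetric] mult.assoc)
    ultimately have "x0 = x * (y * a + qconj x * b)"
      using x0(2) by (simp add: distrib_left)
    then obtain v where v: "x0 = x * v" by blast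
    then have "p = p * qnorm v" using x0(1) x(1) qnorm_mult by metis
    then have nv: "qnorm v = 1" using p0 by simp
    have "x0 * qconj v = x * (v * qconj v)" unfolding v by (simp only: mult.assoc)
    then have x_eq: "x = x0 * qconj v" by (simp add: qconj_mult_self nv)
    have "x * y = x * (v * y0)" using x(2) x0(3) v by (simp only: mult.assoc)
    then have "y = v * y0" using quat_mult_left_cancel nz[OF x(1)] by blast
    then show ?thesis using x_eq nv by (intro exI[of _ "qconj v"]) (simp add: f_def)
  qed
  ultimately have "bij_betw f (sphere 1) (factorizations p w)"
    by (intro bij_betw_imageI) (fastforce simp: image_iff)+
  then show ?thesis using bij_betw_same_card card_units by metis
qed

text \<open>When \<open>p\<close> divides the product, every \<open>x\<close> of norm \<open>p\<close> is a left factor, since \<open>p = x * qconj x\<close>.\<close>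
lemma card_factorizations_multiple:
  assumes "p > 0"
  shows "card (factorizations p (of_int p * w)) = card (sphere p)"
proof -
  have "bij_betw (\<lambda>x. (x, qconj x * w)) (sphere p) (factorizations p (of_int p * w))"
  proof (rule bij_betw_imageI)
    show "inj_on (\<lambda>x. (x, qconj x * w)) (sphere p)" by (auto intro: inj_onI)
    show "(\<lambda>x. (x, qconj x * w)) ` sphere p = factorizations p (of_int p * w)"
    proof (intro equalityI subsetI)
      fix z assume "z \<in> factorizations p (of_int p * w)"
      then obtain x y where z: "z = (x, y)" "qnorm x = p" "x * y = of_int p * w"
        by (auto simp: factorizations_def)
      then have "x * y = x * (qconj x * w)" by (simp add: mult.assoc [symmetric] qconj_mult_self)
      moreover have "x \<noteq> 0" using z(2) assms by (metis qnorm_eq_0_iff less_irrefl)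
      ultimately have "y = qconj x * w" using quat_mult_left_cancel by blast
      then show "z \<in> (\<lambda>x. (x, qconj x * w)) ` sphere p" using z by auto
    qed (auto simp: factorizations_def mult.assoc [symmetric] qconj_mult_self)
  qed
  then show ?thesis using bij_betw_same_card by metis
qed

section \<open>Averaging a quadratic form over quaternions of given norm\<close>

definition monomial_sum :: "nat \<Rightarrow> nat \<Rightarrow> nat \<Rightarrow> nat \<Rightarrow> int \<Rightarrow> int" where
  "monomial_sum i j k l n = (\<Sum>x\<in>sphere n. re x ^ i * im1 x ^ j * im2 x ^ k * im3 x ^ l)"

lemma monomial_sum_swap:
  "monomial_sum i j k l n = monomial_sum j i k l n"
  "monomial_sum i j k l n = monomial_sum i k j l n"
  "monomial_sum i j k l n = monomial_sum i j l k n"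
proof -
  show "monomial_sum i j k l n = monomial_sum j i k l n"
    unfolding monomial_sum_def
    by (rule sum.reindex_bij_witness[of _ "\<lambda>x. Quat (im1 x) (re x) (im2 x) (im3 x)"
        "\<lambda>x. Quat (im1 x) (re x) (im2 x) (im3 x)"]) (simp_all add: qnorm_def)
  show "monomial_sum i j k l n = monomial_sum i k j l n"
    unfolding monomial_sum_def
    by (rule sum.reindex_bij_witness[of _ "\<lambda>x. Quat (re x) (im2 x) (im1 x) (im3 x)"
        "\<lambda>x. Quat (re x) (im2 x) (im1 x) (im3 x)"]) (simp_all add: qnorm_def)
  show "monomial_sum i j k l n = monomial_sum i j l k n"
    unfolding monomial_sum_def
    by (rule sum.reindex_bij_witness[of _ "\<lambda>x. Quat (re x) (im1 x) (im3 x) (im2 x)"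
        "\<lambda>x. Quat (re x) (im1 x) (im3 x) (im2 x)"]) (simp_all add: qnorm_def)
qed

lemma monomial_sum_odd:
  assumes "odd i \<or> odd j \<or> odd k \<or> odd l"
  shows "monomial_sum i j k l n = 0"
proof -
  have odd_re: "monomial_sum i j k l n = 0" if "odd i" for i j k l
  proof -
    have "monomial_sum i j k l n = - monomial_sum i j k l n"
      unfolding monomial_sum_def sum_negf [symmetric]
      by (rule sum.reindex_bij_witness[of _ "\<lambda>x. Quat (- re x) (im1 x) (im2 x) (im3 x)"
            "\<lambda>x. Quat (- re x) (im1 x) (im2 x) (im3 x)"]) (simp_all add: qnorm_def that)
    then show ?thesis by simp
  qed
  show ?thesis using assms odd_re monomial_sum_swap by metis
qed

definition eigen_poly :: "quat \<Rightarrow> int" where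
  "eigen_poly x = re x ^ 4 + im1 x ^ 4 + im2 x ^ 4 + im3 x ^ 4
     - 2 * ((re x)\<^sup>2 * (im1 x)\<^sup>2 + (re x)\<^sup>2 * (im2 x)\<^sup>2 + (re x)\<^sup>2 * (im3 x)\<^sup>2
          + (im1 x)\<^sup>2 * (im2 x)\<^sup>2 + (im1 x)\<^sup>2 * (im3 x)\<^sup>2 + (im2 x)\<^sup>2 * (im3 x)\<^sup>2)"

text \<open>For odd \<open>n\<close> this is eight times the coefficient of $q^n$ in $\eta(2z)^{12}$.\<close>
definition hecke_eigenvalue :: "int \<Rightarrow> int" where
  "hecke_eigenvalue n = (\<Sum>x\<in>sphere n. eigen_poly x)"

text \<open>A quadratic form on the imaginary part.  Any diagonal form with coefficients of sum 0 has the same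
eigenvalue under averaging; this one has integer coefficients and takes the value 1 at the first imaginary unit.\<close>
definition test_form :: "quat \<Rightarrow> int" where
  "test_form v = (im1 v)\<^sup>2 - (im2 v)\<^sup>2"

lemma re_conjugate: "re v = 0 \<Longrightarrow> re (qconj x * v * x) = 0"
  by (simp add: algebra_simps)

text \<open>The difference between the form at \<open>qconj x * v * x\<close> and its intended average, sorted by monomials in the coordinates of
\<open>x\<close>.  Exponents 0 and 1 are written out so that each term matches \<open>monomial_sum\<close>.  In each bracket the terms
with odd exponents sum to 0 over a sphere, and the remaining terms are products of two squares whose
coefficients sum to 0.\<close>
lemma test_form_conjugate:
  fixes x v :: quat
  defines "r \<equiv> re x" and "s \<equiv> im1 x" and "t \<equiv> im2 x" and "u \<equiv> im3 x"
  assumes "re v = 0"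
  shows "test_form (qconj x * v * x) = eigen_poly x * test_form v
    + (im1 v)\<^sup>2 * (4 * (r^2*s^2*t^0*u^0) + 4 * (r^0*s^0*t^2*u^2) - 4 * (r^2*s^0*t^0*u^2)
        - 4 * (r^0*s^2*t^2*u^0) + 8 * (r^1*s^1*t^1*u^1))
    + (im2 v)\<^sup>2 * (4 * (r^2*s^0*t^0*u^2) + 4 * (r^0*s^2*t^2*u^0) - 4 * (r^2*s^0*t^2*u^0)
        - 4 * (r^0*s^2*t^0*u^2) + 8 * (r^1*s^1*t^1*u^1))
    + (im3 v)\<^sup>2 * (4 * (r^0*s^2*t^0*u^2) + 4 * (r^2*s^0*t^2*u^0) - 4 * (r^0*s^0*t^2*u^2)
        - 4 * (r^2*s^2*t^0*u^0) - 16 * (r^1*s^1*t^1*u^1))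
    + im1 v * im2 v * (8 * (r^3*s^0*t^0*u^1) + 8 * (r^0*s^3*t^1*u^0) - 8 * (r^0*s^1*t^3*u^0)
        - 8 * (r^1*s^0*t^0*u^3))
    + im1 v * im3 v * (12 * (r^2*s^1*t^0*u^1) - 4 * (r^3*s^0*t^1*u^0) + 4 * (r^0*s^3*t^0*u^1)
        - 12 * (r^1*s^2*t^1*u^0) - 12 * (r^0*s^1*t^2*u^1) + 4 * (r^1*s^0*t^3*u^0)
        - 4 * (r^0*s^1*t^0*u^3) + 12 * (r^1*s^0*t^1*u^2))
    + im2 v * im3 v * (12 * (r^0*s^2*t^1*u^1) - 12 * (r^1*s^1*t^2*u^0) + 12 * (r^1*s^1*t^0*u^2)
        - 12 * (r^2*s^0*t^1*u^1) - 4 * (r^3*s^1*t^0*u^0) + 4 * (r^1*s^3*t^0*u^0)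
        - 4 * (r^0*s^0*t^3*u^1) + 4 * (r^0*s^0*t^1*u^3))"
proof -
  have 1: "im1 (qconj x * v * x) = (r\<^sup>2 + s\<^sup>2 - t\<^sup>2 - u\<^sup>2) * im1 v + 2 * (s*t + r*u) * im2 v
      + 2 * (s*u - r*t) * im3 v"
    using assms(5) by (simp add: r_def s_def t_def u_def power2_eq_square algebra_simps)
  have 2: "im2 (qconj x * v * x) = 2 * (s*t - r*u) * im1 v + (r\<^sup>2 - s\<^sup>2 + t\<^sup>2 - u\<^sup>2) * im2 v
      + 2 * (t*u + r*s) * im3 v"
    using assms(5) by (simp add: r_def s_def t_def u_def power2_eq_square algebra_simps)
  show ?thesis
    unfolding test_form_def 1 2 eigen_poly_def r_def [symmetric] s_def [symmetric]
      t_def [symmetric] u_def [symmetric]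
    by (simp add: power2_eq_square power3_eq_cube power4_eq_xxxx algebra_simps)
qed

text \<open>The form is an eigenvector of averaging because spheres are invariant under permutations and sign
changes of the coordinates, and these symmetries annihilate all the error terms.\<close>
lemma sum_test_form_conjugate:
  assumes "re v = 0"
  shows "(\<Sum>x\<in>sphere n. test_form (qconj x * v * x)) = hecke_eigenvalue n * test_form v"
proof -
  have sq: "monomial_sum 2 0 2 0 n = monomial_sum 2 2 0 0 n" "monomial_sum 2 0 0 2 n = monomial_sum 2 2 0 0 n"
    "monomial_sum 0 2 2 0 n = monomial_sum 2 2 0 0 n" "monomial_sum 0 2 0 2 n = monomial_sum 2 2 0 0 n"
    "monomial_sum 0 0 2 2 n = monomial_sum 2 2 0 0 n"
    by (metis monomial_sum_swap)+
  show ?thesis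
    unfolding test_form_conjugate[OF assms]
    by (simp only: sum.distrib sum_subtractf sum_distrib_left [symmetric] sum_distrib_right [symmetric]
        monomial_sum_def [symmetric] hecke_eigenvalue_def [symmetric] sq)
       (simp add: monomial_sum_odd)
qed

section \<open>The Hecke relation\<close>

lemma test_form_scale: "test_form (qconj (of_int p * w) * v * (of_int p * w)) = p ^ 4 * test_form (qconj w * v * w)"
proof -
  have "qconj (of_int p * w) * v * (of_int p * w) = of_int (p\<^sup>2) * (qconj w * v * w)"
    by (simp add: quat_eq_iff power2_eq_square algebra_simps)
  then show ?thesis
    by (simp add: test_form_def algebra_simps power2_eq_square power4_eq_xxxx del: of_int_power)
qed

lemma multiples_in_sphere:
  assumes "p > 0"
  shows "{w \<in> sphere (p * n). \<exists>w'. w = of_int p * w'}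
    = (if p dvd n then (\<lambda>w'. of_int p * w') ` sphere (n div p) else {})"
proof -
  have "qnorm (of_int p * w') = p * n \<longleftrightarrow> n = p * qnorm w'" for w'
    using assms by (auto simp: qnorm_mult power2_eq_square)
  then have "{w \<in> sphere (p * n). \<exists>w'. w = of_int p * w'} = (\<lambda>w'. of_int p * w') ` {w'. n = p * qnorm w'}"
    by (auto simp del: qnorm_eq_0_iff)
  also have "{w'. n = p * qnorm w'} = (if p dvd n then sphere (n div p) else {})"
    using assms by (auto simp del: qnorm_eq_0_iff)
  finally show ?thesis by simp
qed

lemma sum_factorizations:
  "(\<Sum>x\<in>sphere p. \<Sum>y\<in>sphere n. f (x * y))
    = (\<Sum>w\<in>sphere (p * n). int (card (factorizations p w)) * f w)"
  if "p > 0" for f :: "quat \<Rightarrow> int"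
proof -
  have fib: "{z \<in> sphere p \<times> sphere n. fst z * snd z = w} = factorizations p w"
    if w: "w \<in> sphere (p * n)" for w
  proof -
    have "qnorm y = n" if "qnorm x = p" "x * y = w" for x y
    proof -
      have "p * qnorm y = qnorm (x * y)" using that(1) by (simp only: qnorm_mult)
      also have "\<dots> = p * n" using that(2) w by simp
      finally have "p * qnorm y = p * n" .
      then show ?thesis using \<open>p > 0\<close> by simp
    qed
    then show ?thesis unfolding factorizations_def set_eq_iff by (simp del: qnorm_eq_0_iff) blast
  qed
  have "(\<Sum>x\<in>sphere p. \<Sum>y\<in>sphere n. f (x * y)) = (\<Sum>z\<in>sphere p \<times> sphere n. f (fst z * snd z))"
    by (simp add: sum.cartesian_product case_prod_unfold)
  also have "\<dots> = (\<Sum>w\<in>sphere (p * n). \<Sum>z | z \<in> sphere p \<times> sphere n \<and> fst z * snd z = w. f (fst z * snd z))"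
    by (rule sum.group [symmetric]) (auto simp: qnorm_mult)
  also have "\<dots> = (\<Sum>w\<in>sphere (p * n). int (card (factorizations p w)) * f w)"
  proof (rule sum.cong)
    fix w assume w: "w \<in> sphere (p * n)"
    have "(\<Sum>z | z \<in> sphere p \<times> sphere n \<and> fst z * snd z = w. f (fst z * snd z))
        = (\<Sum>z\<in>factorizations p w. f w)"
      using fib[OF w] by (intro sum.cong) auto
    then show "(\<Sum>z | z \<in> sphere p \<times> sphere n \<and> fst z * snd z = w. f (fst z * snd z))
        = int (card (factorizations p w)) * f w" by simp
  qed simp
  finally show ?thesis .
qed

text \<open>Applying the averages for \<open>n\<close> and \<open>p\<close> in succession multiplies the form by both eigenvalues.  It also
sums the form over all products \<open>x * y\<close>, where a quaternion of norm \<open>p * n\<close> occurs eight times if \<open>p\<close> does not divide it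
and as often as there are quaternions of norm \<open>p\<close> otherwise.  The multiples \<open>p * w'\<close> contribute the
eigenvalue of \<open>n div p\<close> times $p^4$, the form being quadratic in a vector that is scaled by $p^2$.
As there are $8(p+1)$ quaternions of norm \<open>p\<close> (Jacobi's four-square theorem), that eigenvalue has the coefficient $8p^5$, as it must be
in weight 6.\<close>
theorem hecke_relation:
  fixes p n :: int
  assumes p: "prime p" "odd p"
  shows "hecke_eigenvalue p * hecke_eigenvalue n = 8 * hecke_eigenvalue (p * n)
    + (if p dvd n then (int (card (sphere p)) - 8) * p ^ 4 * hecke_eigenvalue (n div p) else 0)"
proof -
  have p0: "p > 0" using p(1) by (simp add: prime_gt_0_int)
  \<comment> \<open>The form is evaluated where it equals 1, so that sums of \<open>f\<close> are the eigenvalues themselves.\<close>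
  define v where "v = Quat 0 1 0 0"
  have v: "re v = 0" "test_form v = 1" by (simp_all add: v_def test_form_def)
  define f where "f w = test_form (qconj w * v * w)" for w
  have sum_f: "(\<Sum>w\<in>sphere m. f w) = hecke_eigenvalue m" for m
    unfolding f_def using sum_test_form_conjugate[OF v(1)] v(2) by simp
  let ?A = "{w \<in> sphere (p * n). \<exists>w'. w = of_int p * w'}"
  have "(\<Sum>x\<in>sphere p. \<Sum>y\<in>sphere n. f (x * y))
      = (\<Sum>x\<in>sphere p. \<Sum>y\<in>sphere n. test_form (qconj y * (qconj x * v * x) * y))"
    unfolding f_def qconj_mult by (simp only: mult.assoc)
  also have "\<dots> = (\<Sum>x\<in>sphere p. hecke_eigenvalue n * f x)"
    unfolding f_def by (intro sum.cong refl sum_test_form_conjugate re_conjugate v)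
  also have "\<dots> = hecke_eigenvalue p * hecke_eigenvalue n"
    by (simp add: sum_f sum_distrib_left [symmetric])
  finally have "hecke_eigenvalue p * hecke_eigenvalue n
      = (\<Sum>w\<in>sphere (p * n). int (card (factorizations p w)) * f w)"
    using sum_factorizations[OF p0] by simp
  also have "\<dots> = (\<Sum>w\<in>sphere (p * n). 8 * f w
      + (if \<exists>w'. w = of_int p * w' then (int (card (sphere p)) - 8) * f w else 0))"
  proof (rule sum.cong)
    fix w assume "w \<in> sphere (p * n)"
    then have "p dvd qnorm w" by simp
    then show "int (card (factorizations p w)) * f w = 8 * f w
        + (if \<exists>w'. w = of_int p * w' then (int (card (sphere p)) - 8) * f w else 0)"
      using card_factorizations_primitive[OF p] card_factorizations_multiple[OF p0]
      by (auto simp: algebra_simps)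
  qed simp
  also have "\<dots> = (\<Sum>w\<in>sphere (p * n). 8 * f w) + (\<Sum>w\<in>?A. (int (card (sphere p)) - 8) * f w)"
    unfolding sum.distrib by (subst sum.inter_filter) simp_all
  also have "(\<Sum>w\<in>sphere (p * n). 8 * f w) = 8 * hecke_eigenvalue (p * n)"
    unfolding sum_f [symmetric] by (rule sum_distrib_left [symmetric])
  also have "(\<Sum>w\<in>?A. (int (card (sphere p)) - 8) * f w) = (int (card (sphere p)) - 8) * (\<Sum>w\<in>?A. f w)"
    by (rule sum_distrib_left [symmetric])
  also have "(\<Sum>w\<in>?A. f w) = (if p dvd n then p ^ 4 * hecke_eigenvalue (n div p) else 0)"
  proof (cases "p dvd n")
    case True
    have "inj_on (\<lambda>w'. of_int p * w') (sphere (n div p))"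
      using p0 by (auto intro!: inj_onI simp: quat_eq_iff)
    then have "(\<Sum>w\<in>?A. f w) = (\<Sum>w\<in>sphere (n div p). f (of_int p * w))"
      using True unfolding multiples_in_sphere[OF p0] by (simp add: sum.reindex)
    then show ?thesis using True
      by (simp add: f_def test_form_scale sum_distrib_left [symmetric] sum_f[unfolded f_def])
  next
    case False
    then show ?thesis unfolding multiples_in_sphere[OF p0] by simp
  qed
  finally show ?thesis by simp
qed

lemma odd_coprime_8: "odd l \<Longrightarrow> coprime l (8 :: int)"
  using coprime_power_right_iff[of l 2 3] by simp

lemma hecke_eigenvalue_dvd_coprime:
  fixes p n l :: int
  assumes "prime p" "odd p" "l dvd hecke_eigenvalue p" "odd l" "\<not> p dvd n"
  shows "l dvd hecke_eigenvalue (p * n)"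
proof -
  have "l dvd 8 * hecke_eigenvalue (p * n)"
    using hecke_relation[OF assms(1,2), of n] assms(3,5) by (metis add.right_neutral dvd_mult2)
  then show ?thesis using odd_coprime_8[OF assms(4)] by (simp add: coprime_dvd_mult_right_iff)
qed

text \<open>In the relation for \<open>p\<close> and \<open>p * n\<close>, two of the three terms are divisible by \<open>l\<close>.\<close>
lemma hecke_eigenvalue_dvd_square:
  fixes p n l :: int
  assumes "prime p" "odd p" "l dvd hecke_eigenvalue p" "odd l" "l dvd hecke_eigenvalue n"
  shows "l dvd hecke_eigenvalue (p\<^sup>2 * n)"
proof -
  have "p > 0" using assms(1) by (simp add: prime_gt_0_int)
  then have "8 * hecke_eigenvalue (p\<^sup>2 * n) = hecke_eigenvalue p * hecke_eigenvalue (p * n)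
      - (int (card (sphere p)) - 8) * p ^ 4 * hecke_eigenvalue n"
    using hecke_relation[OF assms(1,2), of "p * n"] by (simp add: power2_eq_square mult.assoc)
  then have "l dvd 8 * hecke_eigenvalue (p\<^sup>2 * n)"
    using assms(3,5) by simp
  then show ?thesis using odd_coprime_8[OF assms(4)] by (simp add: coprime_dvd_mult_right_iff)
qed

section \<open>Jacobi's identity for the cube of the Euler product\<close>

abbreviation q :: "int fps" where "q \<equiv> fps_X"

definition euler :: "nat \<Rightarrow> int fps" where
  "euler n = (\<Prod>i<n. 1 - q ^ Suc i)"

lemma euler_0 [simp]: "euler 0 = 1"
  by (simp add: euler_def)

lemma euler_Suc: "euler (Suc n) = euler n * (1 - q ^ Suc n)"
  by (simp add: euler_def mult.commute)

lemma euler_nth_0 [simp]: "fps_nth (euler n) 0 = 1"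
  by (induction n) (simp_all add: euler_Suc)

lemma euler_nonzero [simp]: "euler n \<noteq> 0"
  by (metis euler_nth_0 fps_zero_nth zero_neq_one)

text \<open>The partial products stabilize coefficientwise; congruences modulo powers of \<open>q\<close> stand in for the infinite product.\<close>
lemma euler_mono: "m \<le> n \<Longrightarrow> q ^ Suc m dvd euler n - euler m"
proof (induction n rule: dec_induct)
  case (step n)
  have "q ^ Suc m dvd q ^ Suc n" using step by (intro le_imp_power_dvd) simp
  moreover have "euler (Suc n) - euler m = (euler n - euler m) - q ^ Suc n * euler n"
    by (simp add: euler_Suc algebra_simps)
  ultimately show ?case using step.IH by (simp only: dvd_diff dvd_mult2)
qed simp

lemma euler_cancel: "d dvd euler n * f \<Longrightarrow> d dvd f"
proof -
  assume d: "d dvd euler n * f"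
  have "fps_left_inverse (euler n) 1 * euler n = 1" by (rule fps_left_inverse) simp
  then have "f = fps_left_inverse (euler n) 1 * (euler n * f)" by (simp add: mult.assoc [symmetric])
  then show "d dvd f" using d by (metis dvd_mult)
qed

text \<open>The Gaussian binomial coefficients, given by the form of Pascal's rule that matches multiplying the
product in \<open>coeff_gauss_prod\<close> by its next factor.\<close>
fun qbinom :: "nat \<Rightarrow> nat \<Rightarrow> int fps" where
  "qbinom n 0 = 1"
| "qbinom 0 (Suc k) = 0"
| "qbinom (Suc n) (Suc k) = qbinom n (Suc k) + q ^ (n - k) * qbinom n k"

lemma qbinom_eq_0: "n < k \<Longrightarrow> qbinom n k = 0"
  by (induction n k rule: qbinom.induct) auto

text \<open>The closed formula for Gaussian binomial coefficients, free of division.\<close>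
lemma qbinom_euler: "k \<le> n \<Longrightarrow> qbinom n k * (euler k * euler (n - k)) = euler n"
proof (induction n k rule: qbinom.induct)
  case (3 n k)
  have 2: "qbinom n k * (euler k * euler (n - k)) = euler n" using 3 by simp
  show ?case
  proof (cases "k = n")
    case True
    then show ?thesis using 2 by (simp add: qbinom_eq_0 euler_Suc mult.assoc [symmetric])
  next
    case False
    then have k: "Suc k \<le> n" "n - k = Suc (n - Suc k)" using 3 by auto
    have 1: "qbinom n (Suc k) * (euler (Suc k) * euler (n - Suc k)) = euler n" using 3 k by simp
    have "qbinom (Suc n) (Suc k) * (euler (Suc k) * euler (Suc n - Suc k))
        = qbinom n (Suc k) * (euler (Suc k) * euler (n - Suc k)) * (1 - q ^ (n - k))
          + q ^ (n - k) * (qbinom n k * (euler k * euler (n - k))) * (1 - q ^ Suc k)"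
      using k(2) by (simp add: euler_Suc algebra_simps)
    also have "\<dots> = euler n * (1 - q ^ (n - k) * q ^ Suc k)"
      unfolding 1 2 by (simp add: algebra_simps)
    also have "q ^ (n - k) * q ^ Suc k = q ^ Suc n"
      using k(1) unfolding power_add [symmetric] by (intro arg_cong[where f = "power q"]) simp
    finally show ?thesis by (simp add: euler_Suc)
  qed
qed auto

lemma qbinom_symmetric: "k \<le> n \<Longrightarrow> qbinom n (n - k) = qbinom n k"
proof -
  assume k: "k \<le> n"
  have "qbinom n (n - k) * (euler k * euler (n - k)) = qbinom n k * (euler k * euler (n - k))"
    using qbinom_euler[OF k] qbinom_euler[of "n - k" n] k by (simp add: mult.commute)
  then show ?thesis by simp
qed

text \<open>The q-binomial theorem, in a form homogenized by \<open>y\<close> so that \<open>y = q ^ n\<close> can play the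
role of the substitution of a negative power of \<open>q\<close>.\<close>
lemma coeff_gauss_prod:
  "coeff (\<Prod>i<m. [:y, - (q ^ i):]) k = (-1) ^ k * qbinom m k * q ^ (k choose 2) * y ^ (m - k)"
proof (induction m arbitrary: k)
  case 0
  show ?case by (cases k) (auto simp: numeral_2_eq_2)
next
  case (Suc m)
  have step: "coeff (\<Prod>i<Suc m. [:y, - (q ^ i):]) k
      = y * coeff (\<Prod>i<m. [:y, - (q ^ i):]) k
        - (case k of 0 \<Rightarrow> 0 | Suc j \<Rightarrow> q ^ m * coeff (\<Prod>i<m. [:y, - (q ^ i):]) j)"
    by (simp add: mult.commute[of _ "[:y, _:]"] coeff_pCons split: nat.split)
  show ?case
  proof (cases k)
    case 0
    then show ?thesis unfolding step Suc.IH by (simp add: numeral_2_eq_2)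
  next
    case (Suc j)
    have choose: "Suc j choose 2 = j + (j choose 2)" by (simp add: numeral_2_eq_2)
    have 1: "y * (qbinom m (Suc j) * y ^ (m - Suc j)) = qbinom m (Suc j) * y ^ (m - j)"
    proof (cases "j < m")
      case True
      then have "m - j = Suc (m - Suc j)" by simp
      then show ?thesis by simp
    qed (simp add: qbinom_eq_0)
    have 2: "q ^ m * qbinom m j = q ^ (m - j) * q ^ j * qbinom m j"
    proof (cases "j \<le> m")
      case True
      then show ?thesis by (simp add: power_add [symmetric])
    qed (simp add: qbinom_eq_0)
    have "coeff (\<Prod>i<Suc m. [:y, - (q ^ i):]) k
      = (-1) ^ Suc j * q ^ (Suc j choose 2) * (y * (qbinom m (Suc j) * y ^ (m - Suc j)))
        + (-1) ^ Suc j * q ^ (j choose 2) * y ^ (m - j) * (q ^ m * qbinom m j)"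
      unfolding step Suc.IH by (simp add: Suc algebra_simps)
    also have "\<dots> = (-1) ^ Suc j * q ^ (Suc j choose 2) * y ^ (m - j)
        * (qbinom m (Suc j) + q ^ (m - j) * qbinom m j)"
      unfolding 1 2 choose by (simp add: power_add algebra_simps)
    finally show ?thesis by (simp add: Suc algebra_simps)
  qed
qed

lemma degree_gauss_prod: "degree (\<Prod>i<m. [:y, - (q ^ i):]) \<le> m"
  by (rule degree_le) (simp add: coeff_gauss_prod qbinom_eq_0)

lemma poly_pderiv_1: "degree p \<le> m \<Longrightarrow> poly (pderiv p) 1 = (\<Sum>k\<le>m. of_nat k * coeff p k)"
  for p :: "int fps poly"
proof -
  assume "degree p \<le> m"
  then have "pderiv p = pderiv (\<Sum>k\<le>m. monom (coeff p k) k)"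
    by (simp add: poly_as_sum_of_monoms')
  moreover have "pderiv (\<Sum>k\<le>m. monom (coeff p k) k) = (\<Sum>k\<le>m. pderiv (monom (coeff p k) k))"
    using higher_pderiv_sum[of 1 "\<lambda>k. monom (coeff p k) k" "{..m}"] by simp
  ultimately show ?thesis by (simp add: pderiv_monom poly_sum poly_monom)
qed

definition triangle :: "nat \<Rightarrow> nat" where "triangle j = j * (j + 1) div 2"

lemma two_triangle: "2 * triangle j = j * (j + 1)"
  by (simp add: triangle_def)

lemma two_choose: "2 * (n choose 2) = n * (n - 1)"
  by (cases n) (simp_all add: choose_two)

text \<open>Of the factors $q^n - z q^i$, $0 \le i \le 2n$, only the one with $i = n$ vanishes at $z = 1$.  The derivative of the
product there is thus $-q^n$ times the product of the other factors, which is a power of \<open>q\<close> times the square of \<open>euler n\<close>,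
up to sign.  In the expansion of the derivative, the terms with indices $n - j$ and $n + 1 + j$ have
equal powers of \<open>q\<close> and equal binomial coefficients, but opposite signs, and so combine to the factor $2j + 1$.\<close>
lemma finite_jacobi:
  "(\<Sum>j\<le>n. (-1) ^ j * of_nat (2 * j + 1) * q ^ triangle j * qbinom (2 * n + 1) (n - j)) = euler n ^ 2"
proof -
  \<comment> \<open>The variable of the polynomials is \<open>z\<close>, and \<open>q ^ e\<close> is the power of \<open>q\<close> common to both sides.\<close>
  define P where "P = (\<Prod>i<2 * n + 1. [:q ^ n, - (q ^ i):])"
  define Q where "Q = (\<Prod>i\<in>{..<2 * n + 1} - {n}. [:q ^ n, - (q ^ i):])"
  define e where "e = n + (n choose 2) + n * n"
  define t where "t k = of_nat k * ((-1) ^ k * qbinom (2 * n + 1) k * q ^ (k choose 2) * (q ^ n) ^ (2 * n + 1 - k))" for k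
  have "P = [:q ^ n, - (q ^ n):] * Q"
    unfolding P_def Q_def by (rule prod.remove) auto
  then have "poly (pderiv P) 1 = - (q ^ n) * poly Q 1"
    by (simp only: pderiv_mult poly_add poly_mult) (simp add: pderiv_pCons)
  also have "poly Q 1 = (\<Prod>i\<in>{..<2 * n + 1} - {n}. q ^ n - q ^ i)"
    by (simp add: Q_def poly_prod)
  also have "{..<2 * n + 1} - {n} = {..<n} \<union> (\<lambda>i. n + Suc i) ` {..<n}"
  proof
    show "{..<2 * n + 1} - {n} \<subseteq> {..<n} \<union> (\<lambda>i. n + Suc i) ` {..<n}"
    proof
      fix k assume "k \<in> {..<2 * n + 1} - {n}"
      then have "k < n \<or> k = n + Suc (k - Suc n) \<and> k - Suc n < n" by auto
      then show "k \<in> {..<n} \<union> (\<lambda>i. n + Suc i) ` {..<n}" by blast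
    qed
  qed auto
  also have "(\<Prod>i\<in>{..<n} \<union> (\<lambda>i. n + Suc i) ` {..<n}. q ^ n - q ^ i)
      = (\<Prod>i<n. q ^ n - q ^ i) * (\<Prod>i<n. q ^ n - q ^ (n + Suc i))"
    by (subst prod.union_disjoint) (auto simp: prod.reindex inj_on_def)
  also have "(\<Prod>i<n. q ^ n - q ^ (n + Suc i)) = (\<Prod>i<n. q ^ n * (1 - q ^ Suc i))"
    by (rule prod.cong) (simp_all add: power_add algebra_simps)
  also have "\<dots> = q ^ (n * n) * euler n"
    by (simp add: prod.distrib euler_def power_mult)
  also have "(\<Prod>i<n. q ^ n - q ^ i) = (\<Prod>i<n. - (q ^ i) * (1 - q ^ Suc (n - Suc i)))"
  proof (rule prod.cong)
    fix i assume "i \<in> {..<n}"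
    then have "Suc (n - Suc i) = n - i" "q ^ n = q ^ i * q ^ (n - i)"
      by (auto simp: power_add [symmetric])
    then show "q ^ n - q ^ i = - (q ^ i) * (1 - q ^ Suc (n - Suc i))" by (simp add: algebra_simps)
  qed simp
  also have "\<dots> = (\<Prod>i<n. - (q ^ i)) * euler n"
    unfolding prod.distrib euler_def
    using prod.nat_diff_reindex[of "\<lambda>i. 1 - q ^ Suc i" n] by simp
  also have "(\<Prod>i<n. - (q ^ i)) = (-1) ^ n * q ^ (n choose 2)"
  proof (induction n)
    case (Suc n)
    have "Suc n choose 2 = n + (n choose 2)" by (simp add: numeral_2_eq_2)
    then show ?case by (simp add: Suc power_add algebra_simps)
  qed (simp add: numeral_2_eq_2)
  finally have "poly (pderiv P) 1 = (-1) ^ Suc n * q ^ e * euler n ^ 2"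
    by (simp add: e_def power_add power2_eq_square algebra_simps)
  moreover have "poly (pderiv P) 1 = (\<Sum>k\<le>2 * n + 1. t k)"
    unfolding t_def P_def coeff_gauss_prod [symmetric] by (rule poly_pderiv_1[OF degree_gauss_prod])
  moreover have "(\<Sum>k\<le>2 * n + 1. t k) = (\<Sum>j\<le>n. t (n - j)) + (\<Sum>j\<le>n. t (n + 1 + j))"
  proof -
    have "{..2 * n + 1} = {..n} \<union> {n + 1..2 * n + 1}" by auto
    then have "(\<Sum>k\<le>2 * n + 1. t k) = (\<Sum>k\<le>n. t k) + (\<Sum>k=n + 1..2 * n + 1. t k)"
      by (simp only:) (rule sum.union_disjoint, auto)
    moreover have "(\<Sum>k\<le>n. t k) = (\<Sum>j\<le>n. t (n - j))"
      by (rule sum.reindex_bij_witness[of _ "\<lambda>j. n - j" "\<lambda>j. n - j"]) auto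
    moreover have "(\<Sum>k=n + 1..2 * n + 1. t k) = (\<Sum>j\<le>n. t (n + 1 + j))"
      by (rule sum.reindex_bij_witness[of _ "\<lambda>j. n + 1 + j" "\<lambda>k. k - (n + 1)"]) auto
    ultimately show ?thesis by simp
  qed
  moreover have "t (n - j) + t (n + 1 + j)
      = (-1) ^ Suc n * q ^ e * ((-1) ^ j * of_nat (2 * j + 1) * q ^ triangle j * qbinom (2 * n + 1) (n - j))"
    if jn: "j \<le> n" for j
  proof -
    obtain d where d: "n = j + d" using le_Suc_ex[OF jn] by blast
    \<comment> \<open>The exponents are compared after doubling, which clears the halves in binomials and triangular numbers.\<close>
    have "2 * ((n - j choose 2) + n * (2 * n + 1 - (n - j))) = 2 * (e + triangle j)"
      unfolding distrib_left two_choose two_triangle e_def d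
      by (cases d; cases j) (simp_all add: algebra_simps)
    then have e1: "(n - j choose 2) + n * (2 * n + 1 - (n - j)) = e + triangle j" by simp
    have "2 * ((n + 1 + j choose 2) + n * (2 * n + 1 - (n + 1 + j))) = 2 * (e + triangle j)"
      unfolding distrib_left two_choose two_triangle e_def d
      by (cases d; cases j) (simp_all add: algebra_simps)
    then have e2: "(n + 1 + j choose 2) + n * (2 * n + 1 - (n + 1 + j)) = e + triangle j" by simp
    have sym: "qbinom (2 * n + 1) (n + 1 + j) = qbinom (2 * n + 1) (n - j)"
      using qbinom_symmetric[of "n - j" "2 * n + 1"] jn by (simp add: algebra_simps)
    have sgn: "(-1 :: int fps) ^ (n - j) = (-1) ^ n * (-1) ^ j"
      unfolding d by (cases "even j") (simp_all add: power_add)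
    have t1: "t (n - j) = of_nat (n - j) * ((-1) ^ n * (-1) ^ j) * qbinom (2 * n + 1) (n - j) * q ^ (e + triangle j)"
      unfolding t_def e1 [symmetric] sgn power_add power_mult by (simp add: mult.assoc)
    have t2: "t (n + 1 + j) = - (of_nat (n + 1 + j) * ((-1) ^ n * (-1) ^ j) * qbinom (2 * n + 1) (n - j) * q ^ (e + triangle j))"
      unfolding t_def e2 [symmetric] sym power_add power_mult by (simp add: mult.assoc)
    show ?thesis unfolding t1 t2 using jn
      by (simp add: power_add of_nat_diff algebra_simps)
  qed
  ultimately have "(-1) ^ Suc n * q ^ e * euler n ^ 2 = (\<Sum>j\<le>n. (-1) ^ Suc n * q ^ e *
      ((-1) ^ j * of_nat (2 * j + 1) * q ^ triangle j * qbinom (2 * n + 1) (n - j)))"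
    by (simp add: sum.distrib [symmetric])
  then have "(-1) ^ Suc n * q ^ e * euler n ^ 2 = (-1) ^ Suc n * q ^ e *
      (\<Sum>j\<le>n. (-1) ^ j * of_nat (2 * j + 1) * q ^ triangle j * qbinom (2 * n + 1) (n - j))"
    by (simp only: sum_distrib_left)
  then show ?thesis by simp
qed

definition jacobi :: "nat \<Rightarrow> int fps" where
  "jacobi n = (\<Sum>j\<le>n. (-1) ^ j * of_nat (2 * j + 1) * q ^ triangle j)"

lemma triangle_ge: "j \<le> triangle j"
  using two_triangle[of j] by (cases j) auto

text \<open>Multiplying the finite identity by \<open>euler n\<close> turns each binomial coefficient into 1 up to terms of degree greater than
\<open>n - j\<close>.  The factor \<open>q ^ triangle j\<close>, where \<open>triangle j\<close> is at least \<open>j\<close>, moves these beyond degree \<open>n\<close>.\<close>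
theorem euler_cube: "q ^ Suc n dvd euler n ^ 3 - jacobi n"
proof -
  have "euler n ^ 3 = euler n * euler n ^ 2" by (simp add: power3_eq_cube power2_eq_square)
  also have "\<dots> = (\<Sum>j\<le>n. euler n * ((-1) ^ j * of_nat (2 * j + 1) * q ^ triangle j *
      qbinom (2 * n + 1) (n - j)))"
    unfolding finite_jacobi [symmetric] by (rule sum_distrib_left)
  finally have "euler n ^ 3 - jacobi n = (\<Sum>j\<le>n. euler n * ((-1) ^ j * of_nat (2 * j + 1) *
      q ^ triangle j * qbinom (2 * n + 1) (n - j)) - (-1) ^ j * of_nat (2 * j + 1) * q ^ triangle j)"
    unfolding jacobi_def by (simp only: sum_subtractf)
  also have "\<dots> = (\<Sum>j\<le>n. (-1) ^ j * of_nat (2 * j + 1) * q ^ triangle j *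
      (euler n * qbinom (2 * n + 1) (n - j) - 1))"
    by (intro sum.cong refl) (simp only: right_diff_distrib mult_1_left mult_1_right mult.commute mult.left_commute mult.assoc)
  finally have "euler n ^ 3 - jacobi n = (\<Sum>j\<le>n. (-1) ^ j * of_nat (2 * j + 1) * q ^ triangle j *
      (euler n * qbinom (2 * n + 1) (n - j) - 1))" .
  moreover have "q ^ Suc n dvd (-1) ^ j * of_nat (2 * j + 1) * q ^ triangle j *
      (euler n * qbinom (2 * n + 1) (n - j) - 1)" if j: "j \<le> n" for j
  proof -
    let ?r = "Suc (n - j)" and ?B = "qbinom (2 * n + 1) (n - j)"
    have B: "?B * (euler (n - j) * euler (n + 1 + j)) = euler (2 * n + 1)"
      using qbinom_euler[of "n - j" "2 * n + 1"] j by (simp add: algebra_simps)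
    have c: "q ^ ?r dvd euler m - euler (n - j)" if "n - j \<le> m" for m
      using euler_mono[OF that] .
    have h: "q ^ ?r dvd ?B * euler (n - j) * (euler (n + 1 + j) - euler (n - j))"
      "q ^ ?r dvd euler (2 * n + 1) - euler (n - j)"
      "q ^ ?r dvd euler (n - j) * ?B * (euler n - euler (n - j))"
      using c[of "n + 1 + j"] c[of "2 * n + 1"] c[of n] by (auto intro: dvd_mult)
    have "q ^ ?r dvd (euler (2 * n + 1) - euler (n - j))
        - ?B * euler (n - j) * (euler (n + 1 + j) - euler (n - j))
        + euler (n - j) * ?B * (euler n - euler (n - j))"
      by (rule dvd_add[OF dvd_diff[OF h(2) h(1)] h(3)])
    also have "\<dots> = euler (n - j) * (euler n * ?B - 1)"
      unfolding B [symmetric] by (simp add: algebra_simps)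
    finally have "q ^ ?r dvd euler n * ?B - 1" by (rule euler_cancel)
    then have "q ^ (triangle j + ?r) dvd q ^ triangle j * (euler n * ?B - 1)"
      by (simp only: power_add mult_dvd_mono dvd_refl)
    moreover have "q ^ Suc n dvd q ^ (triangle j + ?r)"
      using triangle_ge[of j] j by (intro le_imp_power_dvd) linarith
    ultimately have "q ^ Suc n dvd q ^ triangle j * (euler n * ?B - 1)" by (rule dvd_trans[rotated])
    from dvd_mult[OF this, of "(-1) ^ j * of_nat (2 * j + 1)"] show ?thesis by (simp only: mult.assoc)
  qed
  ultimately show ?thesis by (auto intro: dvd_sum)
qed

section \<open>Hecke eigenvalues as coefficients of the twelfth power\<close>

text \<open>Jacobi's coefficients, extended to negative indices: the reflection $j \mapsto -1-j$ preserves both $j(j+1)$ and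
the weight, so sums over all integers are twice those over the natural numbers.\<close>
definition odd_weight :: "int \<Rightarrow> int" where
  "odd_weight j = (if even j then 1 else -1) * (2 * j + 1)"

lemma odd_weight_reflect: "odd_weight (-1 - j) = odd_weight j"
  by (simp add: odd_weight_def)

lemma sum_reflection_symmetric:
  fixes f :: "int \<Rightarrow> 'a :: comm_ring_1"
  assumes "\<And>j. f (-1 - j) = f j"
  shows "(\<Sum>j\<in>{-1 - int n..int n}. f j) = 2 * (\<Sum>j\<le>n. f (int j))"
proof -
  have "{-1 - int n..int n} = {-1 - int n..-1} \<union> {0..int n}" by auto
  then have "(\<Sum>j\<in>{-1 - int n..int n}. f j) = (\<Sum>j\<in>{-1 - int n..-1}. f j) + (\<Sum>j\<in>{0..int n}. f j)"
    by (simp only:) (rule sum.union_disjoint, auto)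
  also have "(\<Sum>j\<in>{0..int n}. f j) = (\<Sum>j\<le>n. f (int j))"
    by (rule sum.reindex_bij_witness[of _ int nat]) auto
  also have "(\<Sum>j\<in>{-1 - int n..-1}. f j) = (\<Sum>j\<le>n. f (int j))"
    by (rule sum.reindex_bij_witness[of _ "\<lambda>j. -1 - int j" "\<lambda>j. nat (-1 - j)"]) (auto simp: assms)
  finally show ?thesis by simp
qed

text \<open>The index quadruples contributing to the coefficient \<open>N\<close>, stored as quaternions because they will be
matched with the points of a sphere.\<close>
definition index_set :: "nat \<Rightarrow> quat set" where
  "index_set N = {x. re x * (re x + 1) + im1 x * (im1 x + 1) + im2 x * (im2 x + 1) + im3 x * (im3 x + 1) = 2 * int N}"

definition index_weight :: "quat \<Rightarrow> int" where
  "index_weight x = odd_weight (re x) * odd_weight (im1 x) * odd_weight (im2 x) * odd_weight (im3 x)"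

lemma int_times_Suc_nonneg: "0 \<le> j * (j + 1)" for j :: int
  by (cases "j \<ge> 0") (auto simp: zero_le_mult_iff)

lemma index_bound:
  fixes j :: int
  assumes "j * (j + 1) \<le> 2 * int n"
  shows "j \<in> {-1 - int n..int n}"
proof (rule ccontr)
  assume "j \<notin> {-1 - int n..int n}"
  then consider "j \<ge> int n + 1" | "-1 - j \<ge> int n + 1" by fastforce
  then show False
  proof cases
    case 1
    then have "(int n + 1) * (int n + 2) \<le> j * (j + 1)" by (intro mult_mono) auto
    then show False using assms zero_le_square[of "int n"] by (simp add: algebra_simps)
  next
    case 2
    then have "(int n + 1) * (int n + 2) \<le> (-1 - j) * (-j)" by (intro mult_mono) auto
    then show False using assms zero_le_square[of "int n"] by (simp add: algebra_simps)
  qed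
qed

text \<open>Each of the four factors is half of a sum over integer indices of both signs, whence the factor 16.\<close>
lemma coeff_jacobi_4:
  assumes "N \<le> n"
  shows "16 * fps_nth (jacobi n ^ 4) N = (\<Sum>x\<in>index_set N. index_weight x)"
proof -
  define I where "I = {-1 - int n..int n}"
  define t where "t j = nat (j * (j + 1) div 2)" for j :: int
  define g where "g j = fps_const (odd_weight j) * q ^ t j" for j
  have two_t: "int (t j) * 2 = j * (j + 1)" for j
    using int_times_Suc_nonneg[of j] unfolding t_def by simp
  have "jacobi n = (\<Sum>j\<le>n. g (int j))"
    unfolding jacobi_def
  proof (rule sum.cong)
    fix j
    have "int (t (int j)) * 2 = int (triangle j) * 2"
      using two_t[of "int j"] two_triangle[of j] by (metis (mono_tags) mult.commute of_nat_1 of_nat_add of_nat_mult of_nat_numeral)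
    then have "t (int j) = triangle j" by simp
    moreover have "(-1) ^ j * of_nat (2 * j + 1) = (fps_const (odd_weight (int j)) :: int fps)"
    proof -
      have "odd_weight (int j) = (-1) ^ j * int (2 * j + 1)"
        by (cases "even j") (simp_all add: odd_weight_def)
      then have "fps_const (odd_weight (int j)) = of_int ((-1) ^ j * int (2 * j + 1))"
        using fps_of_int[of "odd_weight (int j)", where 'a = int] by simp
      then show ?thesis by simp
    qed
    ultimately show "(-1) ^ j * of_nat (2 * j + 1) * q ^ triangle j = g (int j)"
      by (simp add: g_def)
  qed simp
  moreover have "g (-1 - j) = g j" for j
    by (simp add: g_def odd_weight_reflect t_def algebra_simps)
  ultimately have theta: "2 * jacobi n = (\<Sum>j\<in>I. g j)"
    unfolding I_def by (simp add: sum_reflection_symmetric)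
  have prod: "g i * g j * g k * g l = fps_const (odd_weight i * odd_weight j * odd_weight k * odd_weight l)
      * q ^ (t i + t j + t k + t l)" for i j k l
    by (simp add: g_def power_add fps_const_mult [symmetric] mult_ac del: fps_const_mult)
  have "16 * jacobi n ^ 4 = (2 * jacobi n) * (2 * jacobi n) * (2 * jacobi n) * (2 * jacobi n)"
    by (simp add: power4_eq_xxxx)
  also have "\<dots> = (\<Sum>i\<in>I. \<Sum>j\<in>I. \<Sum>k\<in>I. \<Sum>l\<in>I. g i * g j * g k * g l)"
    unfolding theta by (simp add: sum_distrib_left sum_distrib_right mult_ac)
  also have "\<dots> = (\<Sum>(i, j, k, l)\<in>I \<times> I \<times> I \<times> I. g i * g j * g k * g l)"
    by (simp add: sum.cartesian_product)
  finally have eq: "16 * jacobi n ^ 4 = (\<Sum>(i, j, k, l)\<in>I \<times> I \<times> I \<times> I. g i * g j * g k * g l)" .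
  have "16 * fps_nth (jacobi n ^ 4) N = fps_nth (16 * jacobi n ^ 4) N"
    by (simp add: numeral_fps_const)
  also have "\<dots> = (\<Sum>(i, j, k, l)\<in>I \<times> I \<times> I \<times> I.
      if N = t i + t j + t k + t l then odd_weight i * odd_weight j * odd_weight k * odd_weight l else 0)"
    unfolding eq prod fps_sum_nth by (intro sum.cong) (auto simp: fps_X_power_nth)
  also have "\<dots> = (\<Sum>x\<in>{x \<in> I \<times> I \<times> I \<times> I. (case x of (i, j, k, l) \<Rightarrow> N = t i + t j + t k + t l)}.
      case x of (i, j, k, l) \<Rightarrow> odd_weight i * odd_weight j * odd_weight k * odd_weight l)"
    by (subst sum.inter_filter) (auto simp: I_def intro!: sum.cong)
  also have "\<dots> = (\<Sum>x\<in>index_set N. index_weight x)"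
  proof (rule sum.reindex_bij_witness[of _ "\<lambda>x. (re x, im1 x, im2 x, im3 x)" "\<lambda>(i, j, k, l). Quat i j k l"])
    have iff: "N = t i + t j + t k + t l \<longleftrightarrow>
        i * (i + 1) + j * (j + 1) + k * (k + 1) + l * (l + 1) = 2 * int N" for i j k l
      unfolding two_t [symmetric] by linarith
    fix x assume x: "x \<in> {x \<in> I \<times> I \<times> I \<times> I. (case x of (i, j, k, l) \<Rightarrow> N = t i + t j + t k + t l)}"
    then show "(case x of (i, j, k, l) \<Rightarrow> Quat i j k l) \<in> index_set N"
      by (auto simp: index_set_def iff)
  next
    have iff: "N = t i + t j + t k + t l \<longleftrightarrow>
        i * (i + 1) + j * (j + 1) + k * (k + 1) + l * (l + 1) = 2 * int N" for i j k l
      unfolding two_t [symmetric] by linarith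
    fix x assume x: "x \<in> index_set N"
    then have eq: "re x * (re x + 1) + im1 x * (im1 x + 1) + im2 x * (im2 x + 1) + im3 x * (im3 x + 1) = 2 * int N"
      by (simp add: index_set_def)
    have "re x \<in> I \<and> im1 x \<in> I \<and> im2 x \<in> I \<and> im3 x \<in> I"
      unfolding I_def using eq assms int_times_Suc_nonneg[of "re x"] int_times_Suc_nonneg[of "im1 x"]
        int_times_Suc_nonneg[of "im2 x"] int_times_Suc_nonneg[of "im3 x"]
      by (intro conjI index_bound) linarith+
    then show "(re x, im1 x, im2 x, im3 x) \<in> {x \<in> I \<times> I \<times> I \<times> I. (case x of (i, j, k, l) \<Rightarrow> N = t i + t j + t k + t l)}"
      using eq by (simp add: iff)
  qed (auto simp: index_weight_def)
  finally show ?thesis .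
qed

lemma finite_index_set: "finite (index_set N)"
proof (rule finite_subset)
  let ?I = "{-1 - int N..int N}"
  show "index_set N \<subseteq> (\<lambda>(i, j, k, l). Quat i j k l) ` (?I \<times> ?I \<times> ?I \<times> ?I)"
  proof
    fix x assume "x \<in> index_set N"
    then have eq: "re x * (re x + 1) + im1 x * (im1 x + 1) + im2 x * (im2 x + 1) + im3 x * (im3 x + 1) = 2 * int N"
      by (simp add: index_set_def)
    have "re x \<in> ?I \<and> im1 x \<in> ?I \<and> im2 x \<in> ?I \<and> im3 x \<in> ?I"
      using eq int_times_Suc_nonneg[of "re x"] int_times_Suc_nonneg[of "im1 x"]
        int_times_Suc_nonneg[of "im2 x"] int_times_Suc_nonneg[of "im3 x"]
      by (intro conjI index_bound) linarith+
    then have "(re x, im1 x, im2 x, im3 x) \<in> ?I \<times> ?I \<times> ?I \<times> ?I" by simp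
    then show "x \<in> (\<lambda>(i, j, k, l). Quat i j k l) ` (?I \<times> ?I \<times> ?I \<times> ?I)"
      by (rule rev_image_eqI) simp
  qed
qed simp

definition coordinate_sum :: "quat \<Rightarrow> int" where
  "coordinate_sum x = re x + im1 x + im2 x + im3 x"

text \<open>Reflecting one coordinate preserves the weight and changes the parity of the coordinate sum.\<close>
lemma sum_index_weight_parity:
  "(\<Sum>x\<in>index_set N. index_weight x) = 2 * (\<Sum>x | x \<in> index_set N \<and> odd (coordinate_sum x). index_weight x)"
proof -
  have "(\<Sum>x | x \<in> index_set N \<and> even (coordinate_sum x). index_weight x)
      = (\<Sum>x | x \<in> index_set N \<and> odd (coordinate_sum x). index_weight x)"
    by (rule sum.reindex_bij_witness[of _ "\<lambda>x. Quat (-1 - re x) (im1 x) (im2 x) (im3 x)"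
          "\<lambda>x. Quat (-1 - re x) (im1 x) (im2 x) (im3 x)"])
      (auto simp: index_set_def coordinate_sum_def index_weight_def odd_weight_reflect algebra_simps)
  moreover have "(\<Sum>x\<in>index_set N. index_weight x)
      = (\<Sum>x | x \<in> index_set N \<and> even (coordinate_sum x). index_weight x)
        + (\<Sum>x | x \<in> index_set N \<and> odd (coordinate_sum x). index_weight x)"
    using sum.union_disjoint[of "{x \<in> index_set N. even (coordinate_sum x)}" "{x \<in> index_set N. odd (coordinate_sum x)}" index_weight]
    by (simp add: finite_index_set disjoint_iff Un_def conj_disj_distribL [symmetric])
  ultimately show ?thesis by simp
qed

definition linear_form_product :: "quat \<Rightarrow> int" where
  "linear_form_product x = (- re x + im1 x + im2 x + im3 x) * (re x - im1 x + im2 x + im3 x)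
     * (re x + im1 x - im2 x + im3 x) * (re x + im1 x + im2 x - im3 x)"

text \<open>The polynomial splits into linear factors up to a monomial with odd exponents, which drops out of sums over spheres.\<close>
lemma eigen_poly_eq: "eigen_poly x = 8 * (re x ^ 1 * im1 x ^ 1 * im2 x ^ 1 * im3 x ^ 1) - linear_form_product x"
  by (simp add: eigen_poly_def linear_form_product_def power2_eq_square power4_eq_xxxx algebra_simps)

lemma odd_coordinate_sum_iff: "odd (coordinate_sum x) \<longleftrightarrow> odd (qnorm x)"
  by (simp add: coordinate_sum_def qnorm_def)

text \<open>On a sphere of odd norm the four linear factors of \<open>linear_form_product\<close> are odd, say \<open>2 * y + 1\<close> with \<open>y\<close> running through the
coordinates of \<open>F x\<close>, and the sum of their squares is four times the norm.  This parametrizes exactly the quadruples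
in \<open>index_set N\<close> with odd coordinate sum, whose sign in the weight is $-1$; the inverse map is \<open>G\<close>.\<close>
lemma hecke_eigenvalue_index:
  "hecke_eigenvalue (2 * int N + 1) = (\<Sum>x | x \<in> index_set N \<and> odd (coordinate_sum x). index_weight x)"
proof -
  have "hecke_eigenvalue (2 * int N + 1) = 8 * monomial_sum 1 1 1 1 (2 * int N + 1)
      + (\<Sum>x\<in>sphere (2 * int N + 1). - linear_form_product x)"
    unfolding hecke_eigenvalue_def eigen_poly_eq monomial_sum_def sum_distrib_left
    by (simp add: sum_subtractf sum_negf)
  also have "monomial_sum 1 1 1 1 (2 * int N + 1) = 0" by (rule monomial_sum_odd) simp
  finally have "hecke_eigenvalue (2 * int N + 1) = (\<Sum>x\<in>sphere (2 * int N + 1). - linear_form_product x)" by simp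
  also have "\<dots> = (\<Sum>x | x \<in> index_set N \<and> odd (coordinate_sum x). index_weight x)"
  proof -
    define F where "F x = (let s = (coordinate_sum x - 1) div 2
      in Quat (s - re x) (s - im1 x) (s - im2 x) (s - im3 x))" for x
    define G where "G x = (let s = (coordinate_sum x + 1) div 2
      in Quat (s - re x) (s - im1 x) (s - im2 x) (s - im3 x))" for x
    have F: "F x \<in> {x \<in> index_set N. odd (coordinate_sum x)} \<and> G (F x) = x \<and> index_weight (F x) = - linear_form_product x"
      if x: "qnorm x = 2 * int N + 1" for x
    proof -
      have "odd (coordinate_sum x)" using x by (simp add: odd_coordinate_sum_iff)
      then obtain s where s: "coordinate_sum x = 2 * s + 1" by (auto elim: oddE)
      have F_eq: "F x = Quat (s - re x) (s - im1 x) (s - im2 x) (s - im3 x)"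
        by (simp add: F_def s)
      have cs: "coordinate_sum (F x) = 2 * s - 1" using s by (simp add: F_eq coordinate_sum_def)
      have G: "G (F x) = x" by (simp add: G_def cs) (simp add: F_eq)
      have re: "re x = 2 * s + 1 - im1 x - im2 x - im3 x" using s by (simp add: coordinate_sum_def)
      have "F x \<in> index_set N"
        using x unfolding F_eq index_set_def qnorm_def
        by (simp add: re power2_eq_square algebra_simps)
      moreover have "index_weight (F x) = - linear_form_product x"
      proof -
        have sgn: "(if even i then 1 else -1) * (if even j then 1 else -1) * (if even k then 1 else -1) * (if even l then 1 else -1)
            = (if even (i + j + k + l) then 1 else - 1 :: int)" for i j k l :: int by auto
        have "index_weight (F x) = (if even (coordinate_sum (F x)) then 1 else -1)
          * ((2 * (s - re x) + 1) * (2 * (s - im1 x) + 1) * (2 * (s - im2 x) + 1) * (2 * (s - im3 x) + 1))"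
          unfolding index_weight_def odd_weight_def coordinate_sum_def sgn [symmetric]
          by (simp add: F_eq mult_ac)
        also have "\<dots> = - linear_form_product x"
          unfolding cs linear_form_product_def re by (simp add: algebra_simps)
        finally show ?thesis .
      qed
      ultimately show ?thesis using cs G by simp
    qed
    have G: "qnorm (G x) = 2 * int N + 1 \<and> F (G x) = x"
      if x: "x \<in> index_set N" "odd (coordinate_sum x)" for x
    proof -
      obtain s where s: "coordinate_sum x = 2 * s + 1" using x(2) by (auto elim: oddE)
      have G_eq: "G x = Quat (s + 1 - re x) (s + 1 - im1 x) (s + 1 - im2 x) (s + 1 - im3 x)"
        by (simp add: G_def s Let_def)
      have cs: "coordinate_sum (G x) = 2 * s + 3" using s by (simp add: G_eq coordinate_sum_def)
      have FG: "F (G x) = x" by (simp add: F_def cs) (simp add: G_eq)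
      have re: "re x = 2 * s + 1 - im1 x - im2 x - im3 x" using s by (simp add: coordinate_sum_def)
      have "qnorm (G x) = 2 * int N + 1"
        using x(1) unfolding G_eq index_set_def qnorm_def
        by (simp add: re power2_eq_square algebra_simps)
      then show ?thesis using FG by simp
    qed
    show ?thesis
      by (rule sum.reindex_bij_witness[of _ G F]) (use F G in auto)
  qed
  finally show ?thesis .
qed

text \<open>The coefficient of the fourth power of Jacobi's series is counted 16 times by \<open>coeff_jacobi_4\<close>, and the eigenvalue twice
by \<open>sum_index_weight_parity\<close>.\<close>
theorem hecke_eigenvalue_eq_coeff:
  assumes "N \<le> n"
  shows "hecke_eigenvalue (2 * int N + 1) = 8 * fps_nth (euler n ^ 12) N"
proof -
  have "euler n ^ 12 - jacobi n ^ 4 = (euler n ^ 3) ^ 4 - jacobi n ^ 4"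
    by (simp flip: power_mult)
  also have "\<dots> = (euler n ^ 3 - jacobi n) * ((euler n ^ 3 + jacobi n) * ((euler n ^ 3)\<^sup>2 + (jacobi n)\<^sup>2))"
    by (simp add: power2_eq_square power4_eq_xxxx algebra_simps)
  finally have "q ^ Suc n dvd euler n ^ 12 - jacobi n ^ 4"
    using euler_cube[of n] by (simp only: dvd_mult2)
  then obtain h where "euler n ^ 12 - jacobi n ^ 4 = q ^ Suc n * h" by blast
  then have "fps_nth (euler n ^ 12 - jacobi n ^ 4) N = 0"
    using assms by (simp add: fps_X_power_mult_nth del: power_Suc)
  then have "fps_nth (euler n ^ 12) N = fps_nth (jacobi n ^ 4) N" by simp
  moreover have "16 * fps_nth (jacobi n ^ 4) N = 2 * hecke_eigenvalue (2 * int N + 1)"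
    unfolding coeff_jacobi_4[OF assms] sum_index_weight_parity hecke_eigenvalue_index ..
  ultimately show ?thesis by simp
qed

section \<open>Regular partitions modulo a prime\<close>

definition partitions_into :: "nat set \<Rightarrow> nat \<Rightarrow> nat multiset set" where
  "partitions_into S n = {P. set_mset P \<subseteq> S \<and> \<Sum>\<^sub># P = n}"

definition partition_series :: "nat set \<Rightarrow> int fps" where
  "partition_series S = Abs_fps (\<lambda>n. int (card (partitions_into S n)))"

lemma finite_partitions_into: "0 \<notin> S \<Longrightarrow> finite (partitions_into S n)"
  by (rule finite_subset[OF _ finite_partitions_of[of n]])
    (auto simp: partitions_into_def partitions_of_def intro: gr0I)

text \<open>A partition either avoids the new part \<open>i\<close> or arises from a smaller one by adding one copy of \<open>i\<close>.\<close>
lemma partition_series_insert: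
  assumes "i \<notin> S" "i > 0" "0 \<notin> S"
  shows "(1 - q ^ i) * partition_series (insert i S) = partition_series S"
proof (rule fps_ext)
  fix n
  let ?T = "insert i S"
  have card: "card (partitions_into ?T n)
      = card (partitions_into S n) + (if i \<le> n then card (partitions_into ?T (n - i)) else 0)"
  proof -
    let ?A = "{P \<in> partitions_into ?T n. i \<in># P}"
    have split: "partitions_into ?T n = partitions_into S n \<union> ?A"
      using assms(1) by (auto simp: partitions_into_def)
    have "card (partitions_into ?T n) = card (partitions_into S n \<union> ?A)"
      by (rule arg_cong[OF split])
    also have "\<dots> = card (partitions_into S n) + card ?A"
    proof (rule card_Un_disjoint)
      show "partitions_into S n \<inter> ?A = {}" using assms(1) by (auto simp: partitions_into_def)
      show "finite ?A" using finite_partitions_into[of ?T n] assms by simp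
    qed (use finite_partitions_into assms in auto)
    also have "?A = (if i \<le> n then add_mset i ` partitions_into ?T (n - i) else {})"
    proof (cases "i \<le> n")
      case True
      have "P \<in> add_mset i ` partitions_into ?T (n - i)" if P: "P \<in> ?A" for P
      proof -
        obtain Q where "P = add_mset i Q" using P by (auto dest: multi_member_split)
        then show ?thesis using P True by (auto simp: partitions_into_def)
      qed
      moreover have "P \<in> ?A" if "P \<in> add_mset i ` partitions_into ?T (n - i)" for P
        using that True by (auto simp: partitions_into_def)
      ultimately have "?A = add_mset i ` partitions_into ?T (n - i)"
        by (intro equalityI subsetI)
      then show ?thesis by (simp only: True if_True)
    next
      case False
      have "i \<notin># P" if "\<Sum>\<^sub># P = n" for P
      proof
        assume "i \<in># P"
        then obtain Q where "P = add_mset i Q" by (auto dest: multi_member_split)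
        then show False using that False by simp
      qed
      then show ?thesis using False by (auto simp: partitions_into_def)
    qed
    also have "card \<dots> = (if i \<le> n then card (partitions_into ?T (n - i)) else 0)"
      by (simp add: card_image inj_on_def)
    finally show ?thesis .
  qed
  have "fps_nth ((1 - q ^ i) * partition_series ?T) n = int (card (partitions_into ?T n))
      - (if i \<le> n then int (card (partitions_into ?T (n - i))) else 0)"
    by (simp add: left_diff_distrib fps_X_power_mult_nth partition_series_def)
  then show "fps_nth ((1 - q ^ i) * partition_series ?T) n = fps_nth (partition_series S) n"
    using card by (simp add: partition_series_def)
qed

lemma prod_partition_series:
  assumes "finite S" "0 \<notin> S"
  shows "(\<Prod>i\<in>S. 1 - q ^ i) * partition_series S = 1"
  using assms
proof (induction S rule: finite_induct)
  case empty
  have "partitions_into {} n = (if n = 0 then {{#}} else {})" for n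
    by (auto simp: partitions_into_def)
  then show ?case by (simp add: partition_series_def fps_eq_iff)
next
  case (insert i S)
  have "(\<Prod>i\<in>insert i S. 1 - q ^ i) * partition_series (insert i S)
      = (\<Prod>i\<in>S. 1 - q ^ i) * ((1 - q ^ i) * partition_series (insert i S))"
    by (simp only: prod.insert[OF insert.hyps] mult_ac)
  also have "(1 - q ^ i) * partition_series (insert i S) = partition_series S"
    by (rule partition_series_insert) (use insert in auto)
  also have "(\<Prod>i\<in>S. 1 - q ^ i) * partition_series S = 1" using insert by simp
  finally show ?case .
qed

lemma part_le_sum_mset: "x \<in># P \<Longrightarrow> x \<le> \<Sum>\<^sub># P" for x :: nat
  by (auto dest!: multi_member_split)

lemma b_eq_partitions_into:
  assumes "N \<le> M"
  shows "b l (int N) = card (partitions_into {i \<in> {1..M}. \<not> l dvd i} N)"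
proof -
  have "regular_partitions l N = partitions_into {i \<in> {1..M}. \<not> l dvd i} N"
  proof -
    have "x \<le> M" if "x \<in># P" "\<Sum>\<^sub># P = N" for x P
      using part_le_sum_mset[OF that(1)] that(2) assms by simp
    then show ?thesis
      unfolding regular_partitions_def partitions_of_def partitions_into_def subset_eq
      by (auto simp: Suc_le_eq)
  qed
  then show ?thesis by (simp add: b_def)
qed

lemma freshman_dream:
  fixes x :: "int fps"
  assumes "prime p" "odd p"
  shows "of_nat p dvd (1 - x) ^ p - (1 - x ^ p)"
proof -
  have p: "p > 0" using assms(1) by (simp add: prime_gt_0_nat)
  define f where "f k = of_nat (p choose k) * (- x) ^ k" for k
  have "(1 - x) ^ p = (- x + 1) ^ p" by simp
  also have "\<dots> = (\<Sum>k\<le>p. f k)" unfolding f_def binomial_ring by simp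
  also have "{..p} = insert 0 (insert p {0<..<p})" using p by auto
  also have "(\<Sum>k\<in>insert 0 (insert p {0<..<p}). f k) = 1 - x ^ p + (\<Sum>k\<in>{0<..<p}. f k)"
    using p assms(2) by (simp add: f_def)
  finally have "(1 - x) ^ p - (1 - x ^ p) = (\<Sum>k\<in>{0<..<p}. f k)" by simp
  moreover have "of_nat p dvd f k" if "k \<in> {0<..<p}" for k
  proof -
    have "p dvd p choose k" using that assms(1) by (intro dvd_choose_prime) auto
    then show ?thesis unfolding f_def by (intro dvd_mult2) (auto elim!: dvdE)
  qed
  then have "of_nat p dvd (\<Sum>k\<in>{0<..<p}. f k)" by (rule dvd_sum)
  ultimately show ?thesis by simp
qed

lemma euler_power_prime:
  assumes "prime p" "odd p"
  shows "of_nat p dvd euler n ^ p - (\<Prod>i<n. 1 - q ^ (p * Suc i))"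
proof (induction n)
  case (Suc n)
  let ?D = "\<lambda>n. \<Prod>i<n. 1 - q ^ (p * Suc i)" and ?x = "q ^ Suc n"
  have "euler (Suc n) ^ p - ?D (Suc n) = (euler n ^ p - ?D n) * (1 - ?x) ^ p + ?D n * ((1 - ?x) ^ p - (1 - ?x ^ p))"
  proof -
    have 1: "euler (Suc n) ^ p = euler n ^ p * (1 - ?x) ^ p"
      by (simp only: euler_Suc power_mult_distrib)
    have 2: "?D (Suc n) = ?D n * (1 - ?x ^ p)"
      by (simp add: power_mult [symmetric] mult.commute del: power_Suc mult_Suc_right mult_Suc)
    show ?thesis unfolding 1 2 by (simp add: algebra_simps del: power_Suc)
  qed
  then show ?case using Suc.IH freshman_dream[OF assms, of ?x] by (simp only: dvd_add dvd_mult dvd_mult2)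
qed simp

text \<open>Cancelling the factors with index divisible by \<open>l\<close>, the generating function of \<open>l\<close>-regular partitions with parts up to
\<open>l * n\<close> is \<open>D\<close> divided by \<open>euler (l * n)\<close>, where \<open>D\<close> is the product of the factors $1 - q^{li}$.
Modulo \<open>l\<close> the numerator is \<open>euler n ^ l\<close>, and up to degree \<open>n\<close> the denominator is \<open>euler n\<close>.\<close>
lemma b_cong_euler_power:
  assumes "prime l" "odd l" "N \<le> n"
  shows "[int (b l (int N)) = fps_nth (euler n ^ (l - 1)) N] (mod int l)"
proof -
  have l: "l > 0" using assms(1) by (simp add: prime_gt_0_nat)
  define S where "S = {i \<in> {1..l * n}. \<not> l dvd i}"
  define B where "B = partition_series S"
  define D where "D = (\<Prod>i<n. 1 - q ^ (l * Suc i))"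
  have "euler (l * n) = (\<Prod>i\<in>{1..l * n}. 1 - q ^ i)"
    unfolding euler_def by (rule prod.reindex_bij_witness[of _ "\<lambda>i. i - 1" Suc]) auto
  also have "{1..l * n} = S \<union> (\<lambda>i. l * Suc i) ` {..<n}"
  proof
    show "{1..l * n} \<subseteq> S \<union> (\<lambda>i. l * Suc i) ` {..<n}"
    proof
      fix i assume i: "i \<in> {1..l * n}"
      show "i \<in> S \<union> (\<lambda>i. l * Suc i) ` {..<n}"
      proof (cases "l dvd i")
        case True
        then obtain k where "i = l * k" by blast
        moreover from this have "k > 0" "k \<le> n" using i l by auto
        ultimately have "i = l * Suc (k - 1)" "k - 1 < n" by auto
        then show ?thesis by blast
      qed (use i in \<open>auto simp: S_def\<close>)
    qed
    show "S \<union> (\<lambda>i. l * Suc i) ` {..<n} \<subseteq> {1..l * n}"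
    proof
      fix k assume "k \<in> S \<union> (\<lambda>i. l * Suc i) ` {..<n}"
      then consider "k \<in> S" | i where "i < n" "k = l * Suc i" by blast
      then show "k \<in> {1..l * n}"
      proof cases
        case 2
        then have "l * Suc i \<le> l * n" by (intro mult_le_mono2) simp
        then show ?thesis using 2 l by simp
      qed (simp add: S_def)
    qed
  qed
  also have "(\<Prod>i\<in>S \<union> (\<lambda>i. l * Suc i) ` {..<n}. 1 - q ^ i) = (\<Prod>i\<in>S. 1 - q ^ i) * D"
    unfolding D_def using l
    by (subst prod.union_disjoint) (auto simp: S_def prod.reindex inj_on_def simp del: mult_Suc_right)
  finally have "euler (l * n) * B = D * ((\<Prod>i\<in>S. 1 - q ^ i) * B)" by (simp add: mult_ac)
  also have "(\<Prod>i\<in>S. 1 - q ^ i) * B = 1"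
    unfolding B_def by (rule prod_partition_series) (auto simp: S_def)
  finally have D: "euler (l * n) * B = D" by simp
  obtain h1 where h1: "euler n ^ l - D = of_nat l * h1"
    using euler_power_prime[OF assms(1,2), of n] unfolding D_def by blast
  obtain h2 where h2: "euler (l * n) - euler n = q ^ Suc n * h2"
    using euler_mono[of n "l * n"] l by auto
  obtain u where u: "u * euler n = 1"
    using fps_left_inverse[of 1 "euler n"] by auto
  have "euler n ^ l = euler n * euler n ^ (l - 1)" using l by (simp add: power_eq_if)
  then have "euler n * (B - euler n ^ (l - 1)) = D - (euler (l * n) - euler n) * B - euler n ^ l"
    by (simp add: D [symmetric] algebra_simps)
  also have "\<dots> = - (of_nat l * h1) - q ^ Suc n * h2 * B" unfolding h1 [symmetric] h2 by simp
  finally have "u * (euler n * (B - euler n ^ (l - 1))) = u * (- (of_nat l * h1) - q ^ Suc n * h2 * B)" by simp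
  then have "B - euler n ^ (l - 1) = of_nat l * (- (u * h1)) - q ^ Suc n * (u * h2 * B)"
    unfolding mult.assoc [symmetric] u by (simp add: algebra_simps)
  then have "fps_nth (B - euler n ^ (l - 1)) N = fps_nth (of_nat l * (- (u * h1))) N
      - fps_nth (q ^ Suc n * (u * h2 * B)) N" by (simp only: fps_sub_nth)
  also have "fps_nth (q ^ Suc n * (u * h2 * B)) N = 0"
    using assms(3) by (simp add: fps_X_power_mult_nth del: power_Suc)
  also have "fps_nth (of_nat l * (- (u * h1))) N = int l * fps_nth (- (u * h1)) N"
    by (simp add: fps_of_nat [symmetric])
  finally have "fps_nth B N - fps_nth (euler n ^ (l - 1)) N = int l * fps_nth (- (u * h1)) N" by simp
  moreover have "fps_nth B N = int (b l (int N))"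
  proof -
    have "N \<le> l * n" using assms(3) l by (metis le_trans mult_le_mono1 nat_mult_1 Suc_leI One_nat_def)
    then show ?thesis by (simp add: B_def partition_series_def S_def b_eq_partitions_into)
  qed
  ultimately show ?thesis by (simp add: cong_iff_dvd_diff)
qed

section \<open>The congruence for 13-regular partitions\<close>

lemma b_13_dvd_iff: "13 dvd b 13 (int N) \<longleftrightarrow> 13 dvd hecke_eigenvalue (2 * int N + 1)"
proof -
  have "[int (b 13 (int N)) = fps_nth (euler N ^ 12) N] (mod 13)"
    using b_cong_euler_power[of 13 N N] by simp
  then have "13 dvd int (b 13 (int N)) \<longleftrightarrow> 13 dvd fps_nth (euler N ^ 12) N"
    by (rule cong_dvd_iff)
  moreover have "13 dvd int (b 13 (int N)) \<longleftrightarrow> 13 dvd b 13 (int N)"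
    using of_nat_dvd_iff[of 13 "b 13 (int N)", where 'a = int] by simp
  moreover have "coprime 13 (8 :: int)" by (rule odd_coprime_8) simp
  ultimately show ?thesis
    unfolding hecke_eigenvalue_eq_coeff[OF order_refl, of N]
    by (simp add: coprime_dvd_mult_right_iff)
qed

lemma hecke_eigenvalue_dvd_squares:
  fixes l :: int
  assumes "finite I" "\<And>i. i \<in> I \<Longrightarrow> prime (p i) \<and> odd (p i) \<and> l dvd hecke_eigenvalue (p i)"
    and "odd l" "l dvd hecke_eigenvalue m"
  shows "l dvd hecke_eigenvalue ((\<Prod>i\<in>I. (p i)\<^sup>2) * m)"
  using assms(1,2)
proof (induction I rule: finite_induct)
  case (insert i I)
  then have "l dvd hecke_eigenvalue ((p i)\<^sup>2 * ((\<Prod>i\<in>I. (p i)\<^sup>2) * m))"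
    using assms(3) by (intro hecke_eigenvalue_dvd_square) auto
  then show ?case using insert by (simp add: mult.assoc)
qed (use assms(4) in simp)

theorem theorem1p3:
  fixes \<alpha> n :: nat and p :: "nat \<Rightarrow> nat" and j :: int
  assumes "\<forall>i \<in> {1..\<alpha> + 1}. prime (p i) \<and> odd (p i)"
    and "\<forall>i \<in> {1..\<alpha> + 1}. [b 13 ((int (p i) - 1) div 2) = 0] (mod 13)"
    and "\<not> [j = 0] (mod int (p (\<alpha> + 1)))"
  shows "[b 13 ((\<Prod>i = 1..\<alpha> + 1. (int (p i))\<^sup>2) * int n
            + ((\<Prod>i = 1..\<alpha>. (int (p i))\<^sup>2) * int (p (\<alpha> + 1)) * (2 * j + int (p (\<alpha> + 1))) - 1) div 2)
          = 0] (mod 13)"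
proof -
  have eig: "prime (int (p i)) \<and> odd (int (p i)) \<and> 13 dvd hecke_eigenvalue (int (p i))"
    if i: "i \<in> {1..\<alpha> + 1}" for i
  proof -
    have pi: "prime (p i)" "odd (p i)" "13 dvd b 13 ((int (p i) - 1) div 2)"
      using assms(1,2) i by (auto simp: cong_0_iff)
    obtain N where N: "p i = 2 * N + 1" using pi(2) by (auto elim: oddE)
    then have N': "int (p i) = 2 * int N + 1" by simp
    have "13 dvd hecke_eigenvalue (int (p i))"
      using pi(3) b_13_dvd_iff[of N] unfolding N' by simp
    then show ?thesis using pi(1,2) by simp
  qed
  \<comment> \<open>With \<open>A\<close> the argument of \<open>b\<close>, the number \<open>2 * A + 1\<close> factors as \<open>P * (r * m)\<close> with \<open>r\<close> prime to \<open>m\<close>.\<close>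
  define r where "r = int (p (\<alpha> + 1))"
  define P where "P = (\<Prod>i = 1..\<alpha>. (int (p i))\<^sup>2)"
  define A where "A = P * r\<^sup>2 * int n + (P * r * (2 * j + r) - 1) div 2"
  define m where "m = 2 * (r * int n + j) + r"
  have r: "prime r" "odd r" "13 dvd hecke_eigenvalue r"
    using eig[of "\<alpha> + 1"] by (auto simp: r_def)
  have "odd P" unfolding P_def using eig by (auto simp: even_prod_iff)
  then have "odd (P * r * (2 * j + r))" using r(2) by simp
  then have "2 * A + 1 = 2 * (P * r\<^sup>2 * int n) + P * r * (2 * j + r)"
    by (auto simp: A_def elim!: oddE)
  also have "\<dots> = P * (r * m)" by (simp add: m_def power2_eq_square algebra_simps)
  finally have A: "2 * A + 1 = P * (r * m)" .
  have "\<not> r dvd m"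
  proof
    assume "r dvd m"
    then have "r dvd m - r - 2 * r * int n" by simp
    then have "r dvd 2 * j" by (simp add: m_def algebra_simps)
    moreover have "coprime r 2" using r(2) by simp
    ultimately have "r dvd j" by (simp add: coprime_dvd_mult_right_iff)
    then show False using assms(3) by (simp add: r_def cong_0_iff)
  qed
  then have "13 dvd hecke_eigenvalue (r * m)"
    using r by (intro hecke_eigenvalue_dvd_coprime) auto
  then have dvd: "13 dvd hecke_eigenvalue (2 * A + 1)"
    unfolding A P_def using eig by (intro hecke_eigenvalue_dvd_squares) auto
  have "13 dvd b 13 A"
  proof (cases "A < 0")
    case True
    then show ?thesis by (simp add: b_neg)
  next
    case False
    then have "A = int (nat A)" by simp
    then show ?thesis using dvd b_13_dvd_iff[of "nat A"] by simp
  qed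
  moreover have "(\<Prod>i = 1..\<alpha> + 1. (int (p i))\<^sup>2) = P * r\<^sup>2" by (simp add: P_def r_def)
  ultimately show ?thesis unfolding cong_0_iff A_def P_def r_def by simp
qed

end
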